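(* Let $(B_t)_{t\ge 0}$ be a standard Brownian motion in $\mathbb{R}^d$, $d\ge 1$, and let $f:[0,1]\to\mathbb{R}^d$ be a càdlàg function. Then, for every non-empty subset $A$ of $[0,1]$, almost surely, $$\overline{\dim}_M G_A(B+f) \geq \max\{\overline{\dim}_M G_A(B),\ \overline{\dim}_M G_A(f)\}$$ and $$\underline{\dim}_M G_A(B+f) \geq \max\{\underline{\dim}_M G_A(B),\ \underline{\dim}_M G_A(f)\}.$$
   Context: For a function $h:[0,1]\to\mathbb{R}^d$ and $A\subseteq[0,1]$, $G_A(h)=\{(t,h(t)):t\in A\}\subset\mathbb{R}^{d+1}$ denotes the graph of $h$ over $A$; $(B+f)(t)=B_t+f(t)$. For a non-empty bounded set $E\subset\mathbb{R}^m$ and $\epsilon>0$, let $P(E,\epsilon)$ be the maximum number of pairwise disjoint balls of radius $\epsilon$ with centers in $E$. The upper and lower Minkowski (box) dimensions of $E$ are $$\overline{\dim}_M(E)=\limsup_{\epsilon\to 0}\frac{\log P(E,\epsilon)}{\log \epsilon^{-1}},\qquad \underline{\dim}_M(E)=\liminf_{\epsilon\to 0}\frac{\log P(E,\epsilon)}{\log \epsilon^{-1}}.$$ *)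

theory Defs
  imports "HOL-Probability.Probability"
begin

text \<open>Only times \<open>t \<ge> 0\<close> matter; \<open>B t\<close> is unconstrained for negative \<open>t\<close>. The density in
  \<open>gaussian_increments\<close> is that of the centred Gaussian law on \<open>real ^ 'd\<close> with covariance matrix
  \<open>(t - s) I\<close>. Continuity of paths and \<open>B 0 = 0\<close> are required almost surely only.\<close>

locale standard_brownian_motion = prob_space M
  for M :: "'w measure" +
  fixes B :: "real \<Rightarrow> 'w \<Rightarrow> real ^ 'd"
  assumes measurable_B: "\<And>t. 0 \<le> t \<Longrightarrow> B t \<in> borel_measurable M"
    and start_zero: "AE \<omega> in M. B 0 \<omega> = 0"
    and indep_increments:
      "\<And>(t :: nat \<Rightarrow> real) n. 0 \<le> t 0 \<Longrightarrow> (\<And>i. i < n \<Longrightarrow> t i \<le> t (Suc i)) \<Longrightarrow>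
        indep_vars (\<lambda>_. borel) (\<lambda>i \<omega>. B (t (Suc i)) \<omega> - B (t i) \<omega>) {..<n}"
    and gaussian_increments:
      "\<And>s t. 0 \<le> s \<Longrightarrow> s < t \<Longrightarrow>
        distributed M lborel (\<lambda>\<omega>. B t \<omega> - B s \<omega>)
          (\<lambda>x. ennreal (\<Prod>i\<in>UNIV. normal_density 0 (sqrt (t - s)) (x $ i)))"
    and continuous_paths: "AE \<omega> in M. continuous_on {0..} (\<lambda>t. B t \<omega>)"

text \<open>One-sided limits are only taken from inside \<open>{a..b}\<close>, so values of \<open>f\<close> outside this interval
  are irrelevant.\<close>

definition cadlag_on :: "real \<Rightarrow> real \<Rightarrow> (real \<Rightarrow> 'a :: topological_space) \<Rightarrow> bool" where
  "cadlag_on a b f \<longleftrightarrow>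
     (\<forall>t\<in>{a..<b}. (f \<longlongrightarrow> f t) (at_right t)) \<and>
     (\<forall>t\<in>{a<..b}. \<exists>l. (f \<longlongrightarrow> l) (at_left t))"

text \<open>The product metric on \<open>real \<times> (real ^ 'd)\<close> is the Euclidean one, so this type is the
  Euclidean space of dimension \<open>d + 1\<close>.\<close>

definition graph_over :: "real set \<Rightarrow> (real \<Rightarrow> 'a) \<Rightarrow> (real \<times> 'a) set" where
  "graph_over A h = {(t, h t) | t. t \<in> A}"

text \<open>A family of disjoint balls is given by its set \<open>C\<close> of centres. If \<open>E\<close> is a bounded subset of
  a Euclidean space and \<open>\<epsilon> > 0\<close>, the cardinalities are bounded and the maximum is attained.\<close>

definition packing_number :: "'a :: metric_space set \<Rightarrow> real \<Rightarrow> nat" where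
  "packing_number E \<epsilon> =
     Max {card C | C. finite C \<and> C \<subseteq> E \<and> disjoint_family_on (\<lambda>x. ball x \<epsilon>) C}"

definition upper_minkowski_dim :: "'a :: metric_space set \<Rightarrow> ereal" where
  "upper_minkowski_dim E =
     Limsup (at_right 0) (\<lambda>\<epsilon>. ereal (ln (real (packing_number E \<epsilon>)) / ln (inverse \<epsilon>)))"

definition lower_minkowski_dim :: "'a :: metric_space set \<Rightarrow> ereal" where
  "lower_minkowski_dim E =
     Liminf (at_right 0) (\<lambda>\<epsilon>. ereal (ln (real (packing_number E \<epsilon>)) / ln (inverse \<epsilon>)))"

end

theory Submission
  imports Defs
begin

text \<open>Let \<open>X = B + f\<close>. A set \<open>T\<close> of \<open>n\<close> times yields about \<open>n\<close> disjoint \<open>\<epsilon>\<close>-balls centred on the graph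
  of \<open>X\<close> as soon as few pairs of points of that graph over \<open>T\<close> are \<open>\<epsilon>\<close>-close (Cauchy--Schwarz), and
  \<open>\<bar>X s - X t\<bar> \<le> \<epsilon>\<close> has probability at most \<open>(\<epsilon> / sqrt \<bar>s - t\<bar>) ^ d\<close> whatever the drift is. Suppose
  that the graph over \<open>T\<close> of some deterministic function \<open>g\<close> is \<open>2\<epsilon>\<close>-separated. Among the pairs whose
  \<open>g\<close>-increment is, up to a factor \<open>\<epsilon> ^ (- \<eta>)\<close>, at most \<open>max \<epsilon> (sqrt \<bar>s - t\<bar>)\<close>, the expected number of
  \<open>\<epsilon>\<close>-close ones is then at most \<open>n\<close> times a small power of \<open>1 / \<epsilon>\<close>, so by Borel--Cantelli this holds
  almost surely along \<open>\<epsilon> = 2 ^ (- m)\<close>.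

  For the comparison with \<open>f\<close> take \<open>g = f\<close>: by the modulus of continuity of \<open>B\<close>, the discarded pairs are
  never \<open>\<epsilon>\<close>-close for \<open>X\<close>. For the comparison with \<open>B\<close> no pair is discarded if \<open>g\<close> is a function with the
  modulus of continuity of \<open>B\<close>; the best \<open>T\<close> obtainable from such \<open>g\<close> is deterministic, and almost surely
  \<open>B\<close> itself is eventually one of the competitors.\<close>

section \<open>Packing numbers and separated sets\<close>

text \<open>The inequality is not strict because the balls of a packing are open: two of them that
  merely touch are disjoint.\<close>

definition separated :: "real \<Rightarrow> 'a::metric_space set \<Rightarrow> bool" where
  "separated r S \<longleftrightarrow> (\<forall>x\<in>S. \<forall>y\<in>S. x \<noteq> y \<longrightarrow> r \<le> dist x y)"

lemma separated_subset: "separated r S \<Longrightarrow> T \<subseteq> S \<Longrightarrow> separated r T"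
  unfolding separated_def by blast

text \<open>The midpoint of two centres lies in both balls as soon as the centres are closer than
  \<open>2 * \<epsilon>\<close>; this is where the linear structure enters. The converse is the
  triangle inequality.\<close>

lemma disjoint_balls_iff_separated:
  fixes C :: "'a::real_normed_vector set"
  assumes "0 < \<epsilon>"
  shows "disjoint_family_on (\<lambda>x. ball x \<epsilon>) C \<longleftrightarrow> separated (2 * \<epsilon>) C"
proof -
  have "ball x \<epsilon> \<inter> ball y \<epsilon> = {} \<longleftrightarrow> 2 * \<epsilon> \<le> dist x y" for x y :: 'a
  proof
    assume disj: "ball x \<epsilon> \<inter> ball y \<epsilon> = {}"
    show "2 * \<epsilon> \<le> dist x y"
    proof (rule ccontr)
      assume "\<not> 2 * \<epsilon> \<le> dist x y"
      then have "midpoint x y \<in> ball x \<epsilon> \<inter> ball y \<epsilon>"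
        by (simp add: dist_midpoint)
      with disj show False by blast
    qed
  next
    assume "2 * \<epsilon> \<le> dist x y"
    show "ball x \<epsilon> \<inter> ball y \<epsilon> = {}"
    proof (rule ccontr)
      assume "ball x \<epsilon> \<inter> ball y \<epsilon> \<noteq> {}"
      then obtain z where "dist x z < \<epsilon>" "dist y z < \<epsilon>" by auto
      then have "dist x y < 2 * \<epsilon>" using dist_triangle2[of x y z] by linarith
      with \<open>2 * \<epsilon> \<le> dist x y\<close> show False by simp
    qed
  qed
  then show ?thesis unfolding disjoint_family_on_def separated_def by simp
qed

text \<open>Volume comparison: the balls of radius \<open>r / 2\<close> around the points of
  \<open>S\<close> are disjoint and lie in the ball of radius \<open>\<rho> + r / 2\<close>.\<close>

lemma card_separated_le_aux:
  fixes S :: "'a::euclidean_space set"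
  assumes "finite S" "separated r S" "S \<subseteq> cball x \<rho>" "0 < r" "0 \<le> \<rho>"
  shows "real (card S) \<le> (1 + 2 * \<rho> / r) ^ DIM('a)"
proof -
  let ?V = "unit_ball_vol (real DIM('a))"
  have disj: "disjoint_family_on (\<lambda>y. ball y (r / 2)) S"
    using disjoint_balls_iff_separated[of "r / 2" S] assms by simp
  have "real (card S) * (?V * (r / 2) ^ DIM('a)) = (\<Sum>y\<in>S. measure lborel (ball y (r / 2)))"
    using \<open>0 < r\<close> by (simp add: content_ball)
  also have "\<dots> = measure lborel (\<Union>y\<in>S. ball y (r / 2))"
    by (rule measure_finite_Union[symmetric])
      (use assms(1) disj emeasure_lborel_ball_finite in \<open>auto simp: less_top\<close>)
  also have "\<dots> \<le> measure lborel (cball x (\<rho> + r / 2))"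
  proof (rule measure_mono_fmeasurable)
    show "(\<Union>y\<in>S. ball y (r / 2)) \<subseteq> cball x (\<rho> + r / 2)"
    proof
      fix z assume "z \<in> (\<Union>y\<in>S. ball y (r / 2))"
      then obtain y where "y \<in> S" "dist y z < r / 2" by auto
      with assms(3) have "dist x y \<le> \<rho>" by auto
      with \<open>dist y z < r / 2\<close> show "z \<in> cball x (\<rho> + r / 2)"
        using dist_triangle[of x z y] by simp
    qed
  qed (use assms(1) in \<open>auto simp: fmeasurable_compact intro!: sets.finite_UN\<close>)
  also have "\<dots> = ?V * (\<rho> + r / 2) ^ DIM('a)"
    using assms by (intro content_cball) simp
  finally have "?V * (real (card S) * (r / 2) ^ DIM('a)) \<le> ?V * (\<rho> + r / 2) ^ DIM('a)"
    by (simp only: mult.left_commute)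
  then have "real (card S) * (r / 2) ^ DIM('a) \<le> (\<rho> + r / 2) ^ DIM('a)"
    by (subst (asm) mult_le_cancel_left_pos) simp_all
  then have "real (card S) \<le> (\<rho> + r / 2) ^ DIM('a) / (r / 2) ^ DIM('a)"
    using \<open>0 < r\<close> by (subst pos_le_divide_eq) simp_all
  also have "\<dots> = ((\<rho> + r / 2) / (r / 2)) ^ DIM('a)"
    by (rule power_divide[symmetric])
  also have "(\<rho> + r / 2) / (r / 2) = 1 + 2 * \<rho> / r"
    using \<open>0 < r\<close> by (simp add: add_divide_distrib)
  finally show ?thesis .
qed

text \<open>An infinite separated set would have finite subsets of every size, all subject to the
  volume bound.\<close>

lemma separated_bounded:
  fixes S :: "'a::euclidean_space set"
  assumes "separated r S" "S \<subseteq> cball x \<rho>" "0 < r" "0 \<le> \<rho>"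
  shows finite_separated: "finite S"
    and card_separated_le: "real (card S) \<le> (1 + 2 * \<rho> / r) ^ DIM('a)"
proof -
  show "finite S"
  proof (rule ccontr)
    assume "infinite S"
    obtain n where n: "(1 + 2 * \<rho> / r) ^ DIM('a) < real n"
      using reals_Archimedean2 by blast
    obtain T where "finite T" "card T = n" "T \<subseteq> S"
      using infinite_arbitrarily_large[OF \<open>infinite S\<close>] by blast
    then have "real n \<le> (1 + 2 * \<rho> / r) ^ DIM('a)"
      using card_separated_le_aux[of T r x \<rho>] separated_subset[OF assms(1)] assms(2-4) by auto
    with n show False by simp
  qed
  then show "real (card S) \<le> (1 + 2 * \<rho> / r) ^ DIM('a)"
    using card_separated_le_aux assms by blast
qed

lemma packing_number_eq:
  fixes E :: "'a::real_normed_vector set"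
  assumes "0 < \<epsilon>"
  shows "packing_number E \<epsilon> = Max {card C | C. finite C \<and> C \<subseteq> E \<and> separated (2 * \<epsilon>) C}"
  unfolding packing_number_def disjoint_balls_iff_separated[OF assms] ..

text \<open>\<open>Max\<close> is meaningful only for finite non-empty sets, so this is what makes
  \<open>packing_number\<close> usable.\<close>

lemma finite_packing_cards:
  fixes E :: "'a::euclidean_space set"
  assumes "bounded E" "0 < \<epsilon>"
  shows "finite {card C | C. finite C \<and> C \<subseteq> E \<and> separated (2 * \<epsilon>) C}"
proof -
  obtain \<rho> where "0 < \<rho>" "E \<subseteq> cball 0 \<rho>"
    using bounded_subset_ballD[OF assms(1), of 0] ball_subset_cball by blast
  have "real (card C) \<le> (1 + 2 * \<rho> / (2 * \<epsilon>)) ^ DIM('a)"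
    if "C \<subseteq> E" "separated (2 * \<epsilon>) C" for C
    using that card_separated_le[of "2 * \<epsilon>" C 0 \<rho>] \<open>0 < \<rho>\<close> \<open>0 < \<epsilon>\<close> \<open>E \<subseteq> cball 0 \<rho>\<close> by auto
  then have "{card C | C. finite C \<and> C \<subseteq> E \<and> separated (2 * \<epsilon>) C}
      \<subseteq> {..nat \<lfloor>(1 + 2 * \<rho> / (2 * \<epsilon>)) ^ DIM('a)\<rfloor>}"
    by (auto simp: le_nat_floor)
  then show ?thesis by (rule finite_subset) simp
qed

lemma card_le_packing_number:
  fixes E :: "'a::euclidean_space set"
  assumes "bounded E" "0 < \<epsilon>" "C \<subseteq> E" "separated (2 * \<epsilon>) C"
  shows "finite C" "card C \<le> packing_number E \<epsilon>"
proof -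
  obtain \<rho> where "0 < \<rho>" "E \<subseteq> cball 0 \<rho>"
    using bounded_subset_ballD[OF assms(1), of 0] ball_subset_cball by blast
  then show "finite C"
    using finite_separated[of "2 * \<epsilon>" C 0 \<rho>] assms by auto
  then show "card C \<le> packing_number E \<epsilon>"
    unfolding packing_number_eq[OF assms(2)]
    using assms(3,4) by (intro Max_ge finite_packing_cards assms(1,2)) blast
qed

lemma packing_number_attained:
  fixes E :: "'a::euclidean_space set"
  assumes "bounded E" "0 < \<epsilon>"
  obtains C where "finite C" "C \<subseteq> E" "separated (2 * \<epsilon>) C" "card C = packing_number E \<epsilon>"
proof -
  have "packing_number E \<epsilon> \<in> {card C | C. finite C \<and> C \<subseteq> E \<and> separated (2 * \<epsilon>) C}"
    unfolding packing_number_eq[OF assms(2)]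
  proof (intro Max_in finite_packing_cards assms)
    have "card ({} :: 'a set) \<in> {card C | C. finite C \<and> C \<subseteq> E \<and> separated (2 * \<epsilon>) C}"
      unfolding separated_def by blast
    then show "{card C | C. finite C \<and> C \<subseteq> E \<and> separated (2 * \<epsilon>) C} \<noteq> {}"
      by blast
  qed
  then show ?thesis using that by auto
qed

lemma packing_number_pos:
  fixes E :: "'a::euclidean_space set"
  assumes "bounded E" "0 < \<epsilon>" "E \<noteq> {}"
  shows "1 \<le> packing_number E \<epsilon>"
proof -
  obtain x where "x \<in> E" using assms(3) by blast
  then show ?thesis
    using card_le_packing_number(2)[OF assms(1,2), of "{x}"] by (simp add: separated_def)
qed

lemma packing_number_antimono:
  fixes E :: "'a::euclidean_space set"
  assumes "bounded E" "0 < \<epsilon>" "\<epsilon> \<le> \<epsilon>'"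
  shows "packing_number E \<epsilon>' \<le> packing_number E \<epsilon>"
proof -
  have "0 < \<epsilon>'" using assms(2,3) by simp
  then obtain C where C: "finite C" "C \<subseteq> E" "separated (2 * \<epsilon>') C" "card C = packing_number E \<epsilon>'"
    using packing_number_attained[OF assms(1)] by blast
  then have "separated (2 * \<epsilon>) C"
    using assms(3) unfolding separated_def by (auto intro: order_trans[of _ "2 * \<epsilon>'"])
  then show ?thesis
    using card_le_packing_number(2)[OF assms(1,2) C(2)] C(4) by simp
qed

text \<open>A packing of maximal cardinality is a net: a point at distance at least
  \<open>2 * \<epsilon>\<close> from all centres could be added to it. The map \<open>p\<close>
  picks some centre within that distance.\<close>

lemma obtain_nearest_net:
  fixes E :: "'a::euclidean_space set"
  assumes "bounded E" "0 < \<epsilon>"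
  obtains C p where "finite C" "C \<subseteq> E" "card C \<le> packing_number E \<epsilon>"
    "\<forall>x\<in>E. p x \<in> C \<and> dist x (p x) < 2 * \<epsilon>"
proof -
  obtain C where C: "finite C" "C \<subseteq> E" "separated (2 * \<epsilon>) C" "card C = packing_number E \<epsilon>"
    using packing_number_attained[OF assms] .
  have "\<exists>c\<in>C. dist x c < 2 * \<epsilon>" if "x \<in> E" for x
  proof (rule ccontr)
    assume *: "\<not> (\<exists>c\<in>C. dist x c < 2 * \<epsilon>)"
    then have "x \<notin> C" using \<open>0 < \<epsilon>\<close> by force
    have "separated (2 * \<epsilon>) (insert x C)"
      using * C(3) unfolding separated_def by (auto simp: dist_commute not_less)
    then have "card (insert x C) \<le> packing_number E \<epsilon>"
      using C(2) \<open>x \<in> E\<close> by (intro card_le_packing_number(2) assms) auto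
    with C(1,4) \<open>x \<notin> C\<close> show False by simp
  qed
  then obtain p where "\<forall>x\<in>E. p x \<in> C \<and> dist x (p x) < 2 * \<epsilon>" by metis
  then show ?thesis using that[of C p] C by simp
qed

text \<open>Changing the radius by a constant factor costs only a constant factor, which disappears
  in the dimension: by the volume bound, few points of a \<open>c * \<epsilon>\<close>-packing share
  a centre of an \<open>\<epsilon>\<close>-net.\<close>

lemma packing_number_scale:
  fixes E :: "'a::euclidean_space set"
  assumes "bounded E" "0 < \<epsilon>" "0 < c"
  shows "real (packing_number E (c * \<epsilon>)) \<le> (1 + 2 / c) ^ DIM('a) * real (packing_number E \<epsilon>)"
proof -
  have "0 < c * \<epsilon>" using assms(2,3) by simp
  then obtain D where D: "finite D" "D \<subseteq> E" "separated (2 * (c * \<epsilon>)) D" "card D = packing_number E (c * \<epsilon>)"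
    using packing_number_attained[OF assms(1)] by blast
  obtain C p where C: "finite C" "C \<subseteq> E" "card C \<le> packing_number E \<epsilon>"
    and p: "\<forall>x\<in>E. p x \<in> C \<and> dist x (p x) < 2 * \<epsilon>"
    using obtain_nearest_net[OF assms(1,2)] .
  have fiber: "real (card {x \<in> D. p x = c'}) \<le> (1 + 2 / c) ^ DIM('a)" if "c' \<in> C" for c'
  proof -
    have "real (card {x \<in> D. p x = c'}) \<le> (1 + 2 * (2 * \<epsilon>) / (2 * (c * \<epsilon>))) ^ DIM('a)"
    proof (rule card_separated_le)
      show "separated (2 * (c * \<epsilon>)) {x \<in> D. p x = c'}"
        using D(3) by (rule separated_subset) auto
      show "{x \<in> D. p x = c'} \<subseteq> cball c' (2 * \<epsilon>)"
      proof
        fix x assume "x \<in> {x \<in> D. p x = c'}"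
        then have "x \<in> E" "p x = c'" using D(2) by auto
        with p have "dist x c' < 2 * \<epsilon>" by blast
        then show "x \<in> cball c' (2 * \<epsilon>)" by (simp add: dist_commute)
      qed
    qed (use assms in auto)
    also have "2 * (2 * \<epsilon>) / (2 * (c * \<epsilon>)) = 2 / c"
      using assms by simp
    finally show ?thesis .
  qed
  have "(\<Union>c'\<in>C. {x \<in> D. p x = c'}) = D" using p D(2) by auto
  then have "card D \<le> (\<Sum>c'\<in>C. card {x \<in> D. p x = c'})"
    using card_UN_le[OF C(1), of "\<lambda>c'. {x \<in> D. p x = c'}"] by simp
  then have "real (card D) \<le> (\<Sum>c'\<in>C. real (card {x \<in> D. p x = c'}))"
    by (simp only: of_nat_sum[symmetric] of_nat_le_iff)
  also have "\<dots> \<le> real (card C) * (1 + 2 / c) ^ DIM('a)"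
    using fiber by (rule sum_bounded_above)
  also have "\<dots> \<le> real (packing_number E \<epsilon>) * (1 + 2 / c) ^ DIM('a)"
    using C(3) assms(3) by (intro mult_right_mono) simp_all
  finally show ?thesis using D(4) by (simp only: mult.commute)
qed

text \<open>Cauchy--Schwarz applied to the fibres of the nearest point map.\<close>

lemma card_le_packing_number_of_near_pairs:
  fixes E :: "'b::euclidean_space set" and F :: "'a \<Rightarrow> 'b"
  assumes "bounded E" "0 < \<epsilon>" "finite T" "F ` T \<subseteq> E" "0 \<le> K"
    and near: "real (card {(i, j) \<in> T \<times> T. dist (F i) (F j) < 4 * \<epsilon>}) \<le> K * real (card T)"
  shows "real (card T) \<le> K * real (packing_number E \<epsilon>)"
proof (cases "T = {}")
  case True
  then show ?thesis using \<open>0 \<le> K\<close> by simp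
next
  case False
  obtain C p where C: "finite C" "C \<subseteq> E" "card C \<le> packing_number E \<epsilon>"
    and p: "\<forall>x\<in>E. p x \<in> C \<and> dist x (p x) < 2 * \<epsilon>"
    using obtain_nearest_net[OF assms(1,2)] .
  define b where "b c = {i \<in> T. p (F i) = c}" for c
  have n_pos: "0 < real (card T)" using False assms(3) by (simp add: card_gt_0_iff)
  have fin: "finite (b c)" for c unfolding b_def using assms(3) by simp
  have "(\<Union>c\<in>C. b c) = T" unfolding b_def using p assms(4) by auto
  moreover have "card (\<Union>c\<in>C. b c) = (\<Sum>c\<in>C. card (b c))"
    by (rule card_UN_disjoint) (use C(1) fin in \<open>auto simp: b_def\<close>)
  ultimately have "card T = (\<Sum>c\<in>C. card (b c))" by simp
  then have CS: "(real (card T))\<^sup>2 \<le> (\<Sum>c\<in>C. (real (card (b c)))\<^sup>2) * real (card C)"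
    using sum_squared_le_sum_of_squares[of "\<lambda>c. real (card (b c))" C] by simp
  have "card (\<Union>c\<in>C. b c \<times> b c) = (\<Sum>c\<in>C. card (b c \<times> b c))"
    by (rule card_UN_disjoint) (use C(1) fin in \<open>auto simp: b_def\<close>)
  then have "(\<Sum>c\<in>C. (real (card (b c)))\<^sup>2) = real (card (\<Union>c\<in>C. b c \<times> b c))"
    by (simp add: card_cartesian_product power2_eq_square)
  \<comment> \<open>Two points with the same centre are both within \<open>2 * \<epsilon>\<close> of
    it, so the squared fibre sizes count only near pairs.\<close>
  moreover have "real (card (\<Union>c\<in>C. b c \<times> b c)) \<le> real (card {(i, j) \<in> T \<times> T. dist (F i) (F j) < 4 * \<epsilon>})"
  proof (intro of_nat_mono card_mono)
    show "finite {(i, j) \<in> T \<times> T. dist (F i) (F j) < 4 * \<epsilon>}"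
      by (rule finite_subset[of _ "T \<times> T"]) (use assms(3) in auto)
    show "(\<Union>c\<in>C. b c \<times> b c) \<subseteq> {(i, j) \<in> T \<times> T. dist (F i) (F j) < 4 * \<epsilon>}"
    proof
      have b_D: "i \<in> T \<and> dist (F i) c < 2 * \<epsilon>" if "i \<in> b c" for c i
      proof -
        from that have "i \<in> T" "p (F i) = c" by (auto simp: b_def)
        moreover from \<open>i \<in> T\<close> assms(4) have "F i \<in> E" by blast
        ultimately show ?thesis using p by blast
      qed
      fix ij assume "ij \<in> (\<Union>c\<in>C. b c \<times> b c)"
      then obtain i j c where ij: "ij = (i, j)" "i \<in> b c" "j \<in> b c" by blast
      have "dist (F i) (F j) < 4 * \<epsilon>"
        using b_D[OF ij(2)] b_D[OF ij(3)] dist_triangle2[of "F i" "F j" c] by linarith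
      then show "ij \<in> {(i, j) \<in> T \<times> T. dist (F i) (F j) < 4 * \<epsilon>}"
        using b_D[OF ij(2)] b_D[OF ij(3)] ij(1) by simp
    qed
  qed
  ultimately have "(\<Sum>c\<in>C. (real (card (b c)))\<^sup>2) \<le> K * real (card T)"
    using near by linarith
  from order_trans[OF CS mult_right_mono[OF this]]
  have "(real (card T))\<^sup>2 \<le> (K * real (card T)) * real (card C)"
    by simp
  then have "real (card T) * real (card T) \<le> (K * real (card C)) * real (card T)"
    by (simp only: power2_eq_square mult_ac)
  then have "real (card T) \<le> K * real (card C)"
    using n_pos by (rule mult_right_le_imp_le)
  also have "\<dots> \<le> K * real (packing_number E \<epsilon>)"
    using C(3) \<open>0 \<le> K\<close> by (intro mult_left_mono) auto
  finally show ?thesis .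
qed

text \<open>Cut \<open>S\<close> into \<open>n\<close> dyadic shells around \<open>x\<close>. The
  volume bound for the number of points in a shell cancels the decay of the summand, so every shell
  contributes at most \<open>5 ^ DIM('a)\<close>. In the application \<open>n\<close> is logarithmic
  in the scale.\<close>

lemma sum_inverse_distance_power_le:
  fixes S :: "'a::euclidean_space set"
  assumes "separated \<epsilon> S" "0 < \<epsilon>"
    and "\<And>y. y \<in> S \<Longrightarrow> \<epsilon> \<le> norm (x - y) \<and> norm (x - y) < 2 ^ n * \<epsilon>"
  shows "(\<Sum>y\<in>S. (\<epsilon> / norm (x - y)) ^ DIM('a)) \<le> real n * 5 ^ DIM('a)"
  using assms
proof (induction n arbitrary: S)
  case 0
  have "S = {}" using 0(3) by fastforce
  then show ?case by simp
next
  case (Suc n)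
  \<comment> \<open>The outermost shell; the induction hypothesis covers the rest.\<close>
  define S1 where "S1 = {y \<in> S. 2 ^ n * \<epsilon> \<le> norm (x - y)}"
  have "S1 \<subseteq> S" by (auto simp: S1_def)
  have S_cball: "S \<subseteq> cball x (2 ^ Suc n * \<epsilon>)"
  proof
    fix y assume "y \<in> S"
    from Suc.prems(3)[OF this] show "y \<in> cball x (2 ^ Suc n * \<epsilon>)" by (simp add: dist_norm)
  qed
  have finS: "finite S"
    using finite_separated[OF Suc.prems(1) S_cball] Suc.prems(2) by simp
  have "(\<Sum>y\<in>S1. (\<epsilon> / norm (x - y)) ^ DIM('a)) \<le> real (card S1) * (1 / 2 ^ n) ^ DIM('a)"
  proof (rule sum_bounded_above)
    fix y assume "y \<in> S1"
    then have le: "2 ^ n * \<epsilon> \<le> norm (x - y)" by (simp add: S1_def)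
    have "0 < 2 ^ n * \<epsilon>" using Suc.prems(2) by simp
    with le have "0 < norm (x - y)" by linarith
    then have "\<epsilon> / norm (x - y) \<le> \<epsilon> / (2 ^ n * \<epsilon>)"
      using le \<open>0 < 2 ^ n * \<epsilon>\<close> Suc.prems(2) by (intro divide_left_mono mult_pos_pos) simp_all
    also have "\<dots> = 1 / 2 ^ n" using Suc.prems(2) by simp
    finally show "(\<epsilon> / norm (x - y)) ^ DIM('a) \<le> (1 / 2 ^ n) ^ DIM('a)"
      using Suc.prems(2) by (intro power_mono) simp_all
  qed
  also have "\<dots> \<le> (5 * 2 ^ n) ^ DIM('a) * (1 / 2 ^ n) ^ DIM('a)"
  proof (rule mult_right_mono)
    have "real (card S1) \<le> (1 + 2 * (2 ^ Suc n * \<epsilon>) / \<epsilon>) ^ DIM('a)"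
    proof (rule card_separated_le)
      show "separated \<epsilon> S1" using Suc.prems(1) \<open>S1 \<subseteq> S\<close> by (rule separated_subset)
      show "S1 \<subseteq> cball x (2 ^ Suc n * \<epsilon>)"
        using \<open>S1 \<subseteq> S\<close> S_cball by (rule order_trans)
    qed (use Suc.prems(2) in auto)
    also have "1 + 2 * (2 ^ Suc n * \<epsilon>) / \<epsilon> = 1 + 4 * 2 ^ n" using Suc.prems(2) by simp
    also have "(1 + 4 * 2 ^ n) ^ DIM('a) \<le> (5 * 2 ^ n :: real) ^ DIM('a)"
    proof (rule power_mono)
      have "(1::real) \<le> 2 ^ n" by simp
      then show "1 + 4 * 2 ^ n \<le> (5 * 2 ^ n :: real)" by linarith
    qed simp
    finally show "real (card S1) \<le> (5 * 2 ^ n) ^ DIM('a)" .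
  qed simp
  also have "\<dots> = 5 ^ DIM('a)"
    unfolding power_mult_distrib[symmetric] by simp
  finally have S1: "(\<Sum>y\<in>S1. (\<epsilon> / norm (x - y)) ^ DIM('a)) \<le> 5 ^ DIM('a)" .
  have "(\<Sum>y\<in>S - S1. (\<epsilon> / norm (x - y)) ^ DIM('a)) \<le> real n * 5 ^ DIM('a)"
  proof (rule Suc.IH)
    show "separated \<epsilon> (S - S1)" using Suc.prems(1) by (rule separated_subset) blast
    show "\<epsilon> \<le> norm (x - y) \<and> norm (x - y) < 2 ^ n * \<epsilon>" if "y \<in> S - S1" for y
      using that Suc.prems(3)[of y] by (auto simp: S1_def)
  qed (rule Suc.prems(2))
  moreover have "(\<Sum>y\<in>S. (\<epsilon> / norm (x - y)) ^ DIM('a))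
      = (\<Sum>y\<in>S - S1. (\<epsilon> / norm (x - y)) ^ DIM('a)) + (\<Sum>y\<in>S1. (\<epsilon> / norm (x - y)) ^ DIM('a))"
    using finS \<open>S1 \<subseteq> S\<close> by (rule sum.subset_diff[rotated])
  ultimately show ?case using S1 by (simp add: distrib_right)
qed

section \<open>Moduli of continuity\<close>

text \<open>The index of the dyadic point rather than the point, so that adjacency of two points of
  one level is a statement about integers.\<close>

definition dyadic_floor :: "nat \<Rightarrow> real \<Rightarrow> nat" where
  "dyadic_floor n t = nat \<lfloor>t * 2 ^ n\<rfloor>"

lemma dyadic_floor_bounds:
  assumes "0 \<le> t"
  shows "real (dyadic_floor n t) \<le> t * 2 ^ n" "t * 2 ^ n < real (dyadic_floor n t) + 1"
proof -
  have "0 \<le> t * 2 ^ n" using assms by simp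
  then have "real (dyadic_floor n t) = of_int \<lfloor>t * 2 ^ n\<rfloor>"
    unfolding dyadic_floor_def by simp
  then show "real (dyadic_floor n t) \<le> t * 2 ^ n" "t * 2 ^ n < real (dyadic_floor n t) + 1"
    by linarith+
qed

section \<open>Chaining: from increments over dyadic intervals to all increments\<close>

context
  fixes h :: "real \<Rightarrow> 'a::real_normed_vector" and \<rho> C :: real
  assumes cont: "continuous_on {0..1} h" and \<rho>: "0 < \<rho>" "\<rho> < 1"
    and inc: "\<And>n k. k < 2 ^ n \<Longrightarrow> norm (h (real (Suc k) / 2 ^ n) - h (real k / 2 ^ n)) \<le> C * \<rho> ^ n"
begin

lemma dyadic_adjacent:
  assumes "0 \<le> C" "\<bar>int k - int l\<bar> \<le> 1" "k \<le> 2 ^ n" "l \<le> 2 ^ n"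
  shows "norm (h (real k / 2 ^ n) - h (real l / 2 ^ n)) \<le> C * \<rho> ^ n"
proof -
  consider "k = l" | "k = Suc l" | "l = Suc k" using assms(2) by linarith
  then show ?thesis
  proof cases
    case 1
    then show ?thesis using assms(1) \<rho> by simp
  next
    case 2
    then show ?thesis using inc[of l n] assms(3) by simp
  next
    case 3
    then show ?thesis using inc[of k n] assms(4) by (simp add: norm_minus_commute)
  qed
qed

lemma dyadic_floor_le:
  assumes "0 \<le> t" "t \<le> 1"
  shows "dyadic_floor n t \<le> 2 ^ n"
proof -
  have "real (dyadic_floor n t) \<le> t * 2 ^ n" using dyadic_floor_bounds(1) assms(1) .
  also have "\<dots> \<le> real (2 ^ n)" using assms(2) by simp
  finally show ?thesis by (simp only: of_nat_le_iff)
qed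

text \<open>The dyadic point of level \<open>n\<close> has index \<open>2 * dyadic_floor n t\<close>
  at level \<open>Suc n\<close>, which is equal or adjacent to the new index. Hence one increment of
  the finer level suffices.\<close>

lemma dyadic_step:
  assumes "0 \<le> C" "0 \<le> t" "t \<le> 1"
  shows "norm (h (real (dyadic_floor (Suc n) t) / 2 ^ Suc n) - h (real (dyadic_floor n t) / 2 ^ n))
    \<le> C * \<rho> ^ Suc n"
proof -
  let ?k = "dyadic_floor n t" and ?l = "dyadic_floor (Suc n) t"
  have eq: "real ?k / 2 ^ n = real (2 * ?k) / 2 ^ Suc n" by simp
  have b: "real ?l \<le> 2 * (t * 2 ^ n)" "2 * (t * 2 ^ n) < real ?l + 1"
    using dyadic_floor_bounds[OF assms(2), of "Suc n"] by (simp_all add: mult_ac)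
  have "real (2 * ?k) < real ?l + 1" "real ?l < real (2 * ?k) + 2"
    using dyadic_floor_bounds[OF assms(2), of n] b by simp_all
  then have "\<bar>int ?l - int (2 * ?k)\<bar> \<le> 1" by linarith
  moreover have "2 * ?k \<le> 2 ^ Suc n" using dyadic_floor_le[OF assms(2,3), of n] by simp
  ultimately show ?thesis
    unfolding eq using dyadic_floor_le[OF assms(2,3), of "Suc n"]
    by (intro dyadic_adjacent assms(1))
qed

text \<open>The steps between consecutive levels form a geometric series; its partial sum is kept in
  closed form for the induction.\<close>

lemma dyadic_tail:
  assumes "0 \<le> C" "0 \<le> t" "t \<le> 1"
  shows "norm (h (real (dyadic_floor (n + j) t) / 2 ^ (n + j)) - h (real (dyadic_floor n t) / 2 ^ n))
    \<le> C * \<rho> ^ Suc n * (1 - \<rho> ^ j) / (1 - \<rho>)"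
proof (induction j)
  case 0
  then show ?case by simp
next
  case (Suc j)
  let ?x = "\<lambda>i. h (real (dyadic_floor i t) / 2 ^ i)"
  have "norm (?x (n + Suc j) - ?x n) \<le> norm (?x (Suc (n + j)) - ?x (n + j)) + norm (?x (n + j) - ?x n)"
    using norm_triangle_ineq[of "?x (Suc (n + j)) - ?x (n + j)" "?x (n + j) - ?x n"] by simp
  also have "\<dots> \<le> C * \<rho> ^ Suc (n + j) + C * \<rho> ^ Suc n * (1 - \<rho> ^ j) / (1 - \<rho>)"
    using dyadic_step[OF assms, of "n + j"] Suc.IH by (rule add_mono)
  also have "C * \<rho> ^ Suc (n + j) = C * \<rho> ^ Suc n * (\<rho> ^ j * (1 - \<rho>)) / (1 - \<rho>)"
    using \<rho>(2) by (simp add: power_add)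
  also have "\<dots> + C * \<rho> ^ Suc n * (1 - \<rho> ^ j) / (1 - \<rho>)
      = C * \<rho> ^ Suc n * (\<rho> ^ j * (1 - \<rho>) + (1 - \<rho> ^ j)) / (1 - \<rho>)"
    by (simp only: distrib_left add_divide_distrib)
  also have "\<rho> ^ j * (1 - \<rho>) + (1 - \<rho> ^ j) = 1 - \<rho> ^ Suc j" by (simp add: algebra_simps)
  finally show ?case .
qed

text \<open>Let the level tend to infinity in the tail estimate: the dyadic points converge to
  \<open>t\<close> and \<open>h\<close> is continuous.\<close>

lemma dyadic_approx:
  assumes "0 \<le> C" "0 \<le> t" "t \<le> 1"
  shows "norm (h t - h (real (dyadic_floor n t) / 2 ^ n)) \<le> C * \<rho> ^ n / (1 - \<rho>)"
proof (rule LIMSEQ_le_const2)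
  let ?d = "\<lambda>j. real (dyadic_floor (n + j) t) / 2 ^ (n + j)"
  have "?d \<longlonglongrightarrow> t"
  proof (rule tendsto_sandwich)
    show "\<forall>\<^sub>F j in sequentially. t - (1 / 2) ^ (n + j) \<le> ?d j"
    proof (intro always_eventually allI)
      fix j
      have "t * 2 ^ (n + j) - 1 \<le> real (dyadic_floor (n + j) t)"
        using dyadic_floor_bounds(2)[OF assms(2), of "n + j"] by linarith
      then have "(t * 2 ^ (n + j) - 1) / 2 ^ (n + j) \<le> ?d j"
        by (rule divide_right_mono) simp
      then show "t - (1 / 2) ^ (n + j) \<le> ?d j"
        by (simp add: diff_divide_distrib power_one_over)
    qed
    show "\<forall>\<^sub>F j in sequentially. ?d j \<le> t"
    proof (intro always_eventually allI)
      fix j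
      show "?d j \<le> t"
        using dyadic_floor_bounds(1)[OF assms(2), of "n + j"] by (subst pos_divide_le_eq) simp_all
    qed
    have "(\<lambda>j. (1 / 2 :: real) ^ (n + j)) \<longlonglongrightarrow> 0"
      using LIMSEQ_ignore_initial_segment[OF LIMSEQ_power_zero[of "1 / 2 :: real"], of n]
      by (simp add: add.commute)
    from tendsto_diff[OF tendsto_const[of t] this]
    show "(\<lambda>j. t - (1 / 2) ^ (n + j)) \<longlonglongrightarrow> t" by simp
  qed (rule tendsto_const)
  moreover have "?d j \<in> {0..1}" for j
  proof -
    have "real (dyadic_floor (n + j) t) \<le> real (2 ^ (n + j))"
      using dyadic_floor_le[OF assms(2,3), of "n + j"] by (simp only: of_nat_le_iff)
    then show ?thesis by simp
  qed
  ultimately have "(\<lambda>j. h (?d j)) \<longlonglongrightarrow> h t"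
    using continuous_on_tendsto_compose[OF cont, of ?d t sequentially] assms(2,3) by simp
  then show "(\<lambda>j. norm (h (?d j) - h (real (dyadic_floor n t) / 2 ^ n)))
      \<longlonglongrightarrow> norm (h t - h (real (dyadic_floor n t) / 2 ^ n))"
    by (intro tendsto_norm tendsto_diff tendsto_const)
  have "norm (h (?d j) - h (real (dyadic_floor n t) / 2 ^ n)) \<le> C * \<rho> ^ n / (1 - \<rho>)" for j
  proof -
    have "\<rho> ^ Suc n * (1 - \<rho> ^ j) \<le> \<rho> ^ n * 1"
      using \<rho> by (intro mult_mono power_decreasing) (auto simp: power_le_one)
    then have "C * \<rho> ^ Suc n * (1 - \<rho> ^ j) \<le> C * \<rho> ^ n"
      using assms(1) by (simp only: mult.assoc mult_1_right mult_left_mono)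
    then have "C * \<rho> ^ Suc n * (1 - \<rho> ^ j) / (1 - \<rho>) \<le> C * \<rho> ^ n / (1 - \<rho>)"
      using \<rho>(2) by (intro divide_right_mono) simp_all
    with dyadic_tail[OF assms, of n j] show ?thesis by (rule order_trans)
  qed
  then show "\<exists>N. \<forall>j\<ge>N. norm (h (?d j) - h (real (dyadic_floor n t) / 2 ^ n)) \<le> C * \<rho> ^ n / (1 - \<rho>)"
    by blast
qed

text \<open>At a level matching their distance, \<open>s\<close> and \<open>t\<close> have equal or
  adjacent dyadic points. The constant \<open>3\<close> stands for the two approximation errors and
  the increment between these points.\<close>

lemma modulus_of_dyadic_increments:
  assumes "s \<in> {0..1}" "t \<in> {0..1}" "\<bar>s - t\<bar> \<le> (1 / 2) ^ n"
  shows "norm (h s - h t) \<le> 3 * C / (1 - \<rho>) * \<rho> ^ n"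
proof -
  have "0 \<le> C"
    using order_trans[OF norm_ge_zero inc[of 0 0]] by simp
  have st: "0 \<le> s" "s \<le> 1" "0 \<le> t" "t \<le> 1" using assms(1,2) by auto
  let ?s = "dyadic_floor n s" and ?t = "dyadic_floor n t"
  have "\<bar>s - t\<bar> * 2 ^ n \<le> (1 / 2) ^ n * 2 ^ n" using assms(3) by (rule mult_right_mono) simp
  then have "\<bar>s * 2 ^ n - t * 2 ^ n\<bar> \<le> 1"
    by (simp add: power_one_over left_diff_distrib[symmetric] abs_mult)
  then have "\<bar>int ?s - int ?t\<bar> \<le> 1"
    using dyadic_floor_bounds[OF st(1), of n] dyadic_floor_bounds[OF st(3), of n] by linarith
  then have adj: "norm (h (real ?s / 2 ^ n) - h (real ?t / 2 ^ n)) \<le> C * \<rho> ^ n"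
    using st by (intro dyadic_adjacent \<open>0 \<le> C\<close> dyadic_floor_le)
  also have "\<dots> \<le> C * \<rho> ^ n / (1 - \<rho>)"
  proof -
    have "C * \<rho> ^ n * (1 - \<rho>) \<le> C * \<rho> ^ n * 1"
      using \<rho> \<open>0 \<le> C\<close> by (intro mult_left_mono) simp_all
    then show ?thesis using \<rho>(2) by (subst pos_le_divide_eq) simp_all
  qed
  finally have "norm (h (real ?s / 2 ^ n) - h (real ?t / 2 ^ n)) \<le> C * \<rho> ^ n / (1 - \<rho>)" .
  moreover have "norm (h s - h t) \<le> norm (h s - h (real ?s / 2 ^ n))
      + norm (h (real ?s / 2 ^ n) - h (real ?t / 2 ^ n)) + norm (h t - h (real ?t / 2 ^ n))"
    by norm
  ultimately have "norm (h s - h t) \<le> 3 * (C * \<rho> ^ n / (1 - \<rho>))"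
    using dyadic_approx[OF \<open>0 \<le> C\<close> st(1,2), of n] dyadic_approx[OF \<open>0 \<le> C\<close> st(3,4), of n] by linarith
  also have "\<dots> = 3 * C / (1 - \<rho>) * \<rho> ^ n" by simp
  finally show ?thesis .
qed

end

lemma dyadic_scale:
  fixes x :: real
  assumes "0 < x" "x \<le> 1"
  obtains n where "(1 / 2) ^ Suc n < x" "x \<le> (1 / 2) ^ n"
proof -
  have "\<exists>n. (1 / 2) ^ n < x" using assms(1) real_arch_pow_inv[of x "1 / 2"] by simp
  define n where "n = (LEAST n. (1 / 2) ^ n < x)"
  have n: "(1 / 2) ^ n < x" unfolding n_def using \<open>\<exists>n. (1 / 2) ^ n < x\<close> by (rule LeastI_ex)
  then have "n \<noteq> 0" using assms(2) by (intro notI) simp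
  then obtain k where "n = Suc k" by (cases n) auto
  moreover have "\<not> (1 / 2) ^ k < x"
    using not_less_Least[of k "\<lambda>n. (1 / 2) ^ n < x"] \<open>n = Suc k\<close> unfolding n_def by simp
  ultimately show ?thesis using that[of k] n by simp
qed

text \<open>The Brownian scaling \<open>sqrt \<bar>s - t\<bar>\<close> up to a factor
  \<open>L\<close>, truncated at \<epsilon> because finer oscillations do not matter at that
  resolution. In the application \<open>L\<close> is a small power of
  \<open>1 / \<epsilon>\<close>.\<close>

definition has_modulus :: "real \<Rightarrow> real \<Rightarrow> (real \<Rightarrow> 'a::real_normed_vector) \<Rightarrow> bool" where
  "has_modulus L \<epsilon> h \<longleftrightarrow>
     (\<forall>s\<in>{0..1}. \<forall>t\<in>{0..1}. norm (h s - h t) \<le> L * max \<epsilon> (sqrt \<bar>s - t\<bar>))"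

text \<open>Chaining yields the square root modulus with an extra factor \<open>sqrt (r ^ n)\<close>
  at level \<open>n\<close>. Because of the truncation only levels up to \<open>2 * m\<close>
  matter, where this factor is at most \<open>r ^ m\<close>; since \<open>r < q\<close>, the
  constants are absorbed into \<open>q ^ m\<close>.\<close>

lemma has_modulus_if_dyadic_increments:
  fixes h :: "real \<Rightarrow> 'a::real_normed_vector"
  assumes cont: "continuous_on {0..1} h" and r: "1 < r" "r < 2" "r < q"
    and inc: "\<And>n k. k < 2 ^ n \<Longrightarrow>
      norm (h (real (Suc k) / 2 ^ n) - h (real k / 2 ^ n)) \<le> C * sqrt (r / 2) ^ n"
  shows "\<forall>\<^sub>F m in sequentially. has_modulus (q ^ m) ((1 / 2) ^ m) h"
proof -
  let ?\<rho> = "sqrt (r / 2)"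
  have \<rho>: "0 < ?\<rho>" "?\<rho> < 1" using r by simp_all
  have "0 \<le> C" using order_trans[OF norm_ge_zero inc[of 0 0]] by simp
  define D where "D = 3 * C / (1 - ?\<rho>)"
  have "0 \<le> D" using \<open>0 \<le> C\<close> \<rho> unfolding D_def by simp
  have mod: "norm (h s - h t) \<le> D * ?\<rho> ^ n"
    if "s \<in> {0..1}" "t \<in> {0..1}" "\<bar>s - t\<bar> \<le> (1 / 2) ^ n" for s t n
    using modulus_of_dyadic_increments[OF cont \<rho> inc that] unfolding D_def by simp
  \<comment> \<open>\<open>D\<close> is the chaining constant; \<open>sqrt 2\<close> pays for
    replacing the dyadic length \<open>(1 / 2) ^ n\<close> by
    \<open>2 * \<bar>s - t\<bar>\<close>.\<close>
  have "(\<lambda>m. D * sqrt 2 * (r / q) ^ m) \<longlonglongrightarrow> D * sqrt 2 * 0"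
    using r by (intro tendsto_mult tendsto_const LIMSEQ_power_zero) simp
  from order_tendstoD(2)[OF this, of 1]
  have "\<forall>\<^sub>F m in sequentially. D * sqrt 2 * (r / q) ^ m < 1" by simp
  then show ?thesis
  proof eventually_elim
    case (elim m)
    then have D: "D * sqrt 2 * r ^ m \<le> q ^ m"
      using r by (simp add: power_divide)
    have sq: "?\<rho> ^ n = sqrt (r ^ n) * sqrt ((1 / 2) ^ n)" for n
      by (simp add: real_sqrt_power[symmetric] real_sqrt_mult[symmetric] power_mult_distrib[symmetric])
    show ?case unfolding has_modulus_def
    proof (intro ballI)
      fix s t :: real assume st: "s \<in> {0..1}" "t \<in> {0..1}"
      \<comment> \<open>\<open>(1 / 2) ^ (2 * m)\<close> is the time distance at which
        \<open>sqrt \<bar>s - t\<bar>\<close> reaches the truncation level. Below it the estimate of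
        level \<open>2 * m\<close> suffices.\<close>
      show "norm (h s - h t) \<le> q ^ m * max ((1 / 2) ^ m) (sqrt \<bar>s - t\<bar>)"
      proof (cases "\<bar>s - t\<bar> \<le> (1 / 2) ^ (2 * m)")
        case True
        have "norm (h s - h t) \<le> D * ?\<rho> ^ (2 * m)" using mod[OF st True] .
        also have "?\<rho> ^ (2 * m) = r ^ m * (1 / 2) ^ m"
          using r by (simp add: power_mult power_divide)
        also have "D * (r ^ m * (1 / 2) ^ m) \<le> q ^ m * (1 / 2) ^ m"
        proof -
          have "1 * (D * r ^ m) \<le> sqrt 2 * (D * r ^ m)"
            using \<open>0 \<le> D\<close> r by (intro mult_right_mono) simp_all
          with D have "D * r ^ m \<le> q ^ m" by (simp add: mult_ac)
          then have "(D * r ^ m) * (1 / 2) ^ m \<le> q ^ m * (1 / 2) ^ m" by (rule mult_right_mono) simp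
          then show ?thesis by (simp only: mult.assoc)
        qed
        also have "\<dots> \<le> q ^ m * max ((1 / 2) ^ m) (sqrt \<bar>s - t\<bar>)"
          using r by (intro mult_left_mono) simp_all
        finally show ?thesis .
      next
        case False
        have "0 < (1 / 2 :: real) ^ (2 * m)" by simp
        then have "0 < \<bar>s - t\<bar>" using False by linarith
        moreover have "\<bar>s - t\<bar> \<le> 1" using st by auto
        ultimately obtain n where n: "(1 / 2) ^ Suc n < \<bar>s - t\<bar>" "\<bar>s - t\<bar> \<le> (1 / 2) ^ n"
          by (rule dyadic_scale)
        have "n \<le> 2 * m"
        proof (rule ccontr)
          assume "\<not> n \<le> 2 * m"
          then have "(1 / 2 :: real) ^ n \<le> (1 / 2) ^ (2 * m)" by (intro power_decreasing) simp_all
          with n(2) False show False by linarith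
        qed
        have "norm (h s - h t) \<le> D * (sqrt (r ^ n) * sqrt ((1 / 2) ^ n))"
          using mod[OF st n(2)] unfolding sq .
        also have "\<dots> \<le> D * (r ^ m * (sqrt 2 * sqrt \<bar>s - t\<bar>))"
        proof (intro mult_left_mono mult_mono \<open>0 \<le> D\<close>)
          have "sqrt (r ^ n) \<le> sqrt (r ^ (2 * m))"
            using r \<open>n \<le> 2 * m\<close> by (intro real_sqrt_le_mono power_increasing) simp_all
          also have "\<dots> = r ^ m" using r by (simp add: power_mult power_even_abs real_sqrt_power)
          finally show "sqrt (r ^ n) \<le> r ^ m" .
          have "(1 / 2) ^ n \<le> 2 * \<bar>s - t\<bar>" using n(1) by simp
          then have "sqrt ((1 / 2) ^ n) \<le> sqrt (2 * \<bar>s - t\<bar>)" by (rule real_sqrt_le_mono)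
          then show "sqrt ((1 / 2) ^ n) \<le> sqrt 2 * sqrt \<bar>s - t\<bar>" by (simp only: real_sqrt_mult)
        qed (use r in simp_all)
        also have "\<dots> = (D * sqrt 2 * r ^ m) * sqrt \<bar>s - t\<bar>" by (simp only: mult_ac)
        also have "\<dots> \<le> q ^ m * max ((1 / 2) ^ m) (sqrt \<bar>s - t\<bar>)"
          using D r by (intro mult_mono) simp_all
        finally show ?thesis .
      qed
    qed
  qed
qed

section \<open>Brownian increments\<close>

context standard_brownian_motion
begin

lemma measurable_increment [measurable]:
  assumes "0 \<le> s" "0 \<le> t"
  shows "(\<lambda>\<omega>. B t \<omega> - B s \<omega>) \<in> borel_measurable M"
  using measurable_B assms by (intro borel_measurable_diff)

lemma gaussian_density_eq:
  fixes x :: "real ^ 'd"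
  assumes "0 < v"
  shows "(\<Prod>i\<in>UNIV. normal_density 0 (sqrt v) (x $ i))
    = (1 / sqrt (2 * pi * v)) ^ CARD('d) * exp (- (norm x)\<^sup>2 / (2 * v))"
proof -
  have "(\<Prod>i\<in>UNIV. normal_density 0 (sqrt v) (x $ i))
      = (\<Prod>i\<in>UNIV. 1 / sqrt (2 * pi * v) * exp (- (x $ i)\<^sup>2 / (2 * v)))"
    using assms by (simp add: normal_density_def)
  also have "\<dots> = (1 / sqrt (2 * pi * v)) ^ CARD('d) * exp (\<Sum>i\<in>UNIV. - (x $ i)\<^sup>2 / (2 * v))"
    by (simp only: prod.distrib prod_constant exp_sum finite)
  also have "(\<Sum>i\<in>UNIV. - (x $ i)\<^sup>2 / (2 * v)) = - (norm x)\<^sup>2 / (2 * v)"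
    by (simp add: norm_vec_def L2_set_def sum_nonneg sum_divide_distrib[symmetric] sum_negf)
  finally show ?thesis .
qed

lemma prob_increment_eq:
  assumes "0 \<le> s" "s < t" "A \<in> sets borel"
  shows "emeasure M {\<omega> \<in> space M. B t \<omega> - B s \<omega> \<in> A} =
    (\<integral>\<^sup>+ x. ennreal ((1 / sqrt (2 * pi * (t - s))) ^ CARD('d) * exp (- (norm x)\<^sup>2 / (2 * (t - s))))
      * indicator A x \<partial>lborel)"
proof -
  have "{\<omega> \<in> space M. B t \<omega> - B s \<omega> \<in> A} = (\<lambda>\<omega>. B t \<omega> - B s \<omega>) -` A \<inter> space M" by auto
  then show ?thesis
    using distributed_emeasure[OF gaussian_increments[OF assms(1,2)], of A] assms(2,3)
    by (simp add: gaussian_density_eq)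
qed

text \<open>The density is at most its value at the origin, and the ball lies in a cube of side
  \<open>2 * \<epsilon>\<close>. The constants disappear since \<open>2 \<le> sqrt (2 * pi)\<close>.
  The bound is uniform in the translation \<open>x\<close>, which is how an arbitrary drift is
  handled.\<close>

lemma prob_increment_ball_le:
  assumes "0 \<le> s" "s < t" "0 \<le> \<epsilon>"
  shows "prob {\<omega> \<in> space M. norm (B t \<omega> - B s \<omega> + x) \<le> \<epsilon>} \<le> (\<epsilon> / sqrt (t - s)) ^ CARD('d)"
proof -
  let ?c = "(1 / sqrt (2 * pi * (t - s))) ^ CARD('d)"
  let ?A = "cball (- x) \<epsilon>" and ?E = "\<epsilon> *\<^sub>R One :: real ^ 'd"
  have eq: "{\<omega> \<in> space M. norm (B t \<omega> - B s \<omega> + x) \<le> \<epsilon>} = {\<omega> \<in> space M. B t \<omega> - B s \<omega> \<in> ?A}"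
    by (auto simp: dist_norm norm_minus_commute algebra_simps)
  have "emeasure M {\<omega> \<in> space M. B t \<omega> - B s \<omega> \<in> ?A}
      \<le> (\<integral>\<^sup>+ (y :: real ^ 'd). ennreal ?c * indicator ?A y \<partial>lborel)"
    unfolding prob_increment_eq[OF assms(1,2) borel_closed[OF closed_cball]]
  proof (intro nn_integral_mono mult_right_mono ennreal_leI)
    fix y :: "real ^ 'd"
    have "?c * exp (- (norm y)\<^sup>2 / (2 * (t - s))) \<le> ?c * 1"
      using assms(2) by (intro mult_left_mono) (simp_all add: divide_nonpos_pos)
    then show "?c * exp (- (norm y)\<^sup>2 / (2 * (t - s))) \<le> ?c" by simp
  qed simp
  also have "\<dots> = ennreal ?c * emeasure lborel ?A"
    by (rule nn_integral_cmult_indicator) simp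
  also have "\<dots> \<le> ennreal ?c * emeasure lborel (cbox (- x - ?E) (- x + ?E))"
  proof (intro mult_left_mono emeasure_mono)
    show "?A \<subseteq> cbox (- x - ?E) (- x + ?E)"
    proof
      fix y assume "y \<in> ?A"
      then have "norm (y - (- x)) \<le> \<epsilon>" by (simp add: dist_norm norm_minus_commute)
      then have *: "\<bar>(y - (- x)) \<bullet> b\<bar> \<le> \<epsilon>" if "b \<in> Basis" for b
        using Basis_le_norm[OF that, of "y - (- x)"] by linarith
      have "(- x - ?E) \<bullet> b \<le> y \<bullet> b \<and> y \<bullet> b \<le> (- x + ?E) \<bullet> b" if "b \<in> Basis" for b
        using *[OF that] that
        by (auto simp: inner_diff_left inner_add_left abs_le_iff inner_sum_left_Basis)
      then show "y \<in> cbox (- x - ?E) (- x + ?E)" by (simp add: mem_box)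
    qed
  qed simp_all
  also have "emeasure lborel (cbox (- x - ?E) (- x + ?E)) = ennreal ((2 * \<epsilon>) ^ CARD('d))"
  proof -
    have "- x + ?E - (- x - ?E) = (2 * \<epsilon>) *\<^sub>R One" by (simp add: scaleR_2[symmetric])
    then show ?thesis
      using assms(3) by (subst emeasure_lborel_cbox)
        (simp_all add: inner_diff_left inner_add_left inner_sum_left_Basis)
  qed
  also have "ennreal ?c * ennreal ((2 * \<epsilon>) ^ CARD('d)) = ennreal ((1 / sqrt (2 * pi * (t - s)) * (2 * \<epsilon>)) ^ CARD('d))"
    using assms by (subst ennreal_mult[symmetric]) (simp_all only: power_mult_distrib, simp_all)
  also have "\<dots> \<le> ennreal ((\<epsilon> / sqrt (t - s)) ^ CARD('d))"
  proof (intro ennreal_leI power_mono)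
    have "2 = sqrt 4" by simp
    also have "\<dots> \<le> sqrt (2 * pi)" using pi_ge_two by (intro real_sqrt_le_mono) simp
    finally have "2 \<le> sqrt (2 * pi)" .
    then have "1 / sqrt (2 * pi) * 2 \<le> 1" by simp
    then have "(1 / sqrt (2 * pi) * 2) * (\<epsilon> / sqrt (t - s)) \<le> 1 * (\<epsilon> / sqrt (t - s))"
      using assms by (intro mult_right_mono) simp_all
    then show "1 / sqrt (2 * pi * (t - s)) * (2 * \<epsilon>) \<le> \<epsilon> / sqrt (t - s)"
      by (simp add: real_sqrt_mult)
  qed (use assms in simp)
  finally have "emeasure M {\<omega> \<in> space M. B t \<omega> - B s \<omega> \<in> ?A} \<le> ennreal ((\<epsilon> / sqrt (t - s)) ^ CARD('d))" .
  then show ?thesis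
    unfolding eq emeasure_eq_measure using assms by (subst (asm) ennreal_le_iff) simp_all
qed

text \<open>Beyond radius \<open>a\<close> the density of variance \<open>v\<close> is at most \<open>sqrt 2 ^ d * exp (- a\<^sup>2 / (4 * v))\<close>
  times the density of variance \<open>2 * v\<close>, which is that of another increment.\<close>

lemma prob_increment_tail_le:
  assumes "0 \<le> s" "s < t" "0 \<le> a"
  shows "prob {\<omega> \<in> space M. a < norm (B t \<omega> - B s \<omega>)}
    \<le> sqrt 2 ^ CARD('d) * exp (- a\<^sup>2 / (4 * (t - s)))"
proof -
  define v where "v = t - s"
  have v: "0 < v" using assms unfolding v_def by simp
  let ?c = "\<lambda>v. (1 / sqrt (2 * pi * v)) ^ CARD('d)"
  let ?K = "sqrt 2 ^ CARD('d) * exp (- a\<^sup>2 / (4 * v))"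
  let ?A = "- cball 0 a :: (real ^ 'd) set"
  have A: "?A \<in> sets borel" by simp
  have eq: "{\<omega> \<in> space M. a < norm (B t \<omega> - B s \<omega>)} = {\<omega> \<in> space M. B t \<omega> - B s \<omega> \<in> ?A}"
    by auto
  have c: "?c v = sqrt 2 ^ CARD('d) * ?c (2 * v)"
  proof -
    have "1 / sqrt (2 * pi * v) = sqrt 2 * (1 / sqrt (2 * pi * (2 * v)))"
      using real_sqrt_mult[of 2 "2 * pi * v"] by (simp add: mult_ac)
    then show ?thesis by (simp only: power_mult_distrib)
  qed
  have dens: "?c v * exp (- (norm y)\<^sup>2 / (2 * v))
      \<le> ?K * (?c (2 * v) * exp (- (norm y)\<^sup>2 / (2 * (2 * v))))" if "a < norm y" for y :: "real ^ 'd"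
  proof -
    have "a\<^sup>2 \<le> (norm y)\<^sup>2" using that assms(3) by (intro power_mono) simp_all
    then have "a\<^sup>2 / (4 * v) \<le> (norm y)\<^sup>2 / (4 * v)" using v by (intro divide_right_mono) simp_all
    moreover have "(norm y)\<^sup>2 / (2 * v) = (norm y)\<^sup>2 / (4 * v) + (norm y)\<^sup>2 / (4 * v)"
      using v by (simp add: add_divide_distrib[symmetric])
    ultimately have "exp (- (norm y)\<^sup>2 / (2 * v)) \<le> exp (- a\<^sup>2 / (4 * v) + - (norm y)\<^sup>2 / (2 * (2 * v)))"
      by simp
    then have "?c v * exp (- (norm y)\<^sup>2 / (2 * v))
        \<le> ?c v * (exp (- a\<^sup>2 / (4 * v)) * exp (- (norm y)\<^sup>2 / (2 * (2 * v))))"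
      using v unfolding exp_add by (intro mult_left_mono) simp_all
    then show ?thesis unfolding c by (simp only: mult_ac)
  qed
  have "emeasure M {\<omega> \<in> space M. B t \<omega> - B s \<omega> \<in> ?A}
      \<le> (\<integral>\<^sup>+ (y :: real ^ 'd). ennreal ?K * (ennreal (?c (2 * v) * exp (- (norm y)\<^sup>2 / (2 * (2 * v)))) * indicator UNIV y) \<partial>lborel)"
    unfolding prob_increment_eq[OF assms(1,2) A] v_def[symmetric]
  proof (rule nn_integral_mono)
    fix y :: "real ^ 'd"
    show "ennreal (?c v * exp (- (norm y)\<^sup>2 / (2 * v))) * indicator ?A y
        \<le> ennreal ?K * (ennreal (?c (2 * v) * exp (- (norm y)\<^sup>2 / (2 * (2 * v)))) * indicator UNIV y)"
    proof (cases "y \<in> ?A")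
      case True
      then have "ennreal (?c v * exp (- (norm y)\<^sup>2 / (2 * v)))
          \<le> ennreal (?K * (?c (2 * v) * exp (- (norm y)\<^sup>2 / (2 * (2 * v)))))"
        by (intro ennreal_leI dens) simp
      also have "\<dots> = ennreal ?K * ennreal (?c (2 * v) * exp (- (norm y)\<^sup>2 / (2 * (2 * v))))"
        using v by (intro ennreal_mult) simp_all
      finally show ?thesis using True by simp
    next
      case False
      then show ?thesis by simp
    qed
  qed
  also have "\<dots> = ennreal ?K * emeasure M {\<omega> \<in> space M. B (s + 2 * v) \<omega> - B s \<omega> \<in> UNIV}"
  proof -
    have "s < s + 2 * v" using v by simp
    from prob_increment_eq[OF assms(1) this, of UNIV]
    have "emeasure M {\<omega> \<in> space M. B (s + 2 * v) \<omega> - B s \<omega> \<in> UNIV} =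
        (\<integral>\<^sup>+ (y :: real ^ 'd). ennreal (?c (2 * v) * exp (- (norm y)\<^sup>2 / (2 * (2 * v)))) * indicator UNIV y \<partial>lborel)"
      by simp
    then show ?thesis by (subst nn_integral_cmult) simp_all
  qed
  also have "\<dots> = ennreal ?K" by (simp add: emeasure_space_1)
  finally show ?thesis
    unfolding eq emeasure_eq_measure v_def by (subst (asm) ennreal_le_iff) simp_all
qed

end

text \<open>The factor \<open>2 ^ n\<close> will count the dyadic intervals of level
  \<open>n\<close> in a union bound.\<close>

lemma summable_double_exponential:
  assumes "1 < (r::real)"
  shows "summable (\<lambda>n. 2 ^ n * exp (- (r ^ n) / 4))"
proof (rule summable_comparison_test_ev)
  have "(\<lambda>n. real n * (1 / r) ^ n) \<longlonglongrightarrow> 0"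
    using assms by (intro powser_times_n_limit_0) simp
  \<comment> \<open>With \<open>1 / 8\<close>, eventually \<open>r ^ n / 4\<close> exceeds
    \<open>2 * n\<close>, so the exponential is at most \<open>(1 / 4) ^ n\<close> and beats
    \<open>2 ^ n\<close>.\<close>
  from order_tendstoD(2)[OF this, of "1 / 8"]
  have "\<forall>\<^sub>F n in sequentially. real n * (1 / r) ^ n < 1 / 8" by simp
  then show "\<forall>\<^sub>F n in sequentially. norm (2 ^ n * exp (- (r ^ n) / 4)) \<le> (1 / 2) ^ n"
  proof eventually_elim
    case (elim n)
    have "0 < r ^ n" using assms by simp
    then have "8 * real n < r ^ n" using elim by (simp add: power_one_over field_simps)
    then have "exp (- (r ^ n) / 4) \<le> exp (real n * (- 2))" by simp
    also have "\<dots> = exp (- 2) ^ n" by (rule exp_of_nat_mult)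
    also have "\<dots> \<le> (1 / 4 :: real) ^ n"
    proof (rule power_mono)
      have "2 * 2 \<le> exp 1 * exp (1 :: real)"
        using exp_ge_add_one_self[of 1] by (intro mult_mono) simp_all
      also have "\<dots> = exp 2" unfolding exp_add[symmetric] by simp
      finally show "exp (- 2) \<le> (1 / 4 :: real)" by (simp add: exp_minus field_simps)
    qed simp
    finally have "2 ^ n * exp (- (r ^ n) / 4) \<le> 2 ^ n * (1 / 4) ^ n"
      by (rule mult_left_mono) simp
    also have "\<dots> = (1 / 2) ^ n" unfolding power_mult_distrib[symmetric] by simp
    finally show ?case by simp
  qed
  show "summable (\<lambda>n. (1 / 2 :: real) ^ n)" by (rule summable_geometric) simp
qed

section \<open>Counting close pairs\<close>

text \<open>Distance in the graph is at most distance in time plus distance in space, so nearby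
  times force separated values. This is why \<open>near_pairs\<close> also restricts the distance in
  time.\<close>

lemma separated_graph:
  assumes "separated (2 * \<epsilon>) ((\<lambda>t. (t, g t)) ` T)" "i \<in> T" "j \<in> T" "i \<noteq> j" "\<bar>i - j\<bar> \<le> \<epsilon>"
  shows "\<epsilon> \<le> norm (g i - g j)"
proof -
  have "2 * \<epsilon> \<le> dist (i, g i) (j, g j)"
    using assms(1-4) unfolding separated_def by blast
  also have "\<dots> \<le> dist i j + dist (g i) (g j)"
    unfolding dist_Pair_Pair by (rule sqrt_sum_squares_le_sum) simp_all
  finally show ?thesis using assms(5) by (simp add: dist_norm)
qed

text \<open>The bound on \<open>X\<close> is the only random condition on a pair; the two others select the pairs whose
  probability of being close can be summed.\<close>

definition near_pairs ::
    "real \<Rightarrow> real \<Rightarrow> (real \<Rightarrow> 'a) \<Rightarrow> (real \<Rightarrow> 'a :: real_normed_vector) \<Rightarrow> real set \<Rightarrow> (real \<times> real) set" where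
  "near_pairs \<epsilon> L g X T = (SIGMA i:T. {j \<in> T. (\<bar>i - j\<bar> \<le> \<epsilon> / 2 \<and>
     norm (g i - g j) \<le> 2 * L * max \<epsilon> (sqrt \<bar>i - j\<bar>)) \<and> norm (X i - X j) \<le> \<epsilon>})"

context standard_brownian_motion
begin

text \<open>An increment of level \<open>n\<close> has variance \<open>1 / 2 ^ n\<close> per
  coordinate, so the squared threshold is \<open>r ^ n\<close> times the variance. The Gaussian tail
  then survives the union over \<open>2 ^ n\<close> intervals, and Borel--Cantelli applies.\<close>

lemma AE_eventually_small_dyadic_increments:
  assumes "1 < r"
  shows "AE \<omega> in M. \<forall>\<^sub>F n in sequentially. \<forall>k<2 ^ n.
    norm (B (real (Suc k) / 2 ^ n) \<omega> - B (real k / 2 ^ n) \<omega>) \<le> sqrt (r / 2) ^ n"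
proof -
  define N where "N n k = {\<omega> \<in> space M. sqrt (r / 2) ^ n < norm (B (real (Suc k) / 2 ^ n) \<omega> - B (real k / 2 ^ n) \<omega>)}"
    for n k
  define A where "A n = (\<Union>k<2 ^ n. N n k)" for n
  have N_sets: "N n k \<in> sets M" for n k
  proof -
    have "(\<lambda>\<omega>. B (real (Suc k) / 2 ^ n) \<omega> - B (real k / 2 ^ n) \<omega>) \<in> borel_measurable M"
      by (intro measurable_increment) simp_all
    then show ?thesis unfolding N_def by measurable
  qed
  have N_prob: "prob (N n k) \<le> sqrt 2 ^ CARD('d) * exp (- (r ^ n) / 4)" for n k
  proof -
    have "real (Suc k) / 2 ^ n - real k / 2 ^ n = 1 / 2 ^ n"
      by (simp add: diff_divide_distrib[symmetric])
    moreover have "(sqrt (r / 2) ^ n)\<^sup>2 = r ^ n / 2 ^ n"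
      using assms by (simp add: power_mult[symmetric] mult.commute[of n] power_mult power_divide)
    moreover have "real k / 2 ^ n < real (Suc k) / 2 ^ n" by (intro divide_strict_right_mono) simp_all
    ultimately show ?thesis
      using prob_increment_tail_le[of "real k / 2 ^ n" "real (Suc k) / 2 ^ n" "sqrt (r / 2) ^ n"] assms
      unfolding N_def by simp
  qed
  have A_prob: "prob (A n) \<le> sqrt 2 ^ CARD('d) * (2 ^ n * exp (- (r ^ n) / 4))" for n
  proof -
    have "prob (A n) \<le> (\<Sum>k<2 ^ n. prob (N n k))"
      unfolding A_def using N_sets by (intro finite_measure_subadditive_finite) auto
    also have "\<dots> \<le> (\<Sum>k<(2::nat) ^ n. sqrt 2 ^ CARD('d) * exp (- (r ^ n) / 4))"
      by (intro sum_mono N_prob)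
    also have "\<dots> = sqrt 2 ^ CARD('d) * (2 ^ n * exp (- (r ^ n) / 4))" by simp
    finally show ?thesis .
  qed
  have "summable (\<lambda>n. prob (A n))"
  proof (rule summable_comparison_test')
    show "summable (\<lambda>n. sqrt 2 ^ CARD('d) * (2 ^ n * exp (- (r ^ n) / 4)))"
      by (intro summable_mult summable_double_exponential assms)
    show "norm (prob (A n)) \<le> sqrt 2 ^ CARD('d) * (2 ^ n * exp (- (r ^ n) / 4))" if "0 \<le> n" for n
      using A_prob[of n] by simp
  qed
  moreover have "A n \<in> sets M" for n
    unfolding A_def using N_sets by (intro sets.finite_UN) auto
  ultimately have "AE \<omega> in M. \<forall>\<^sub>F n in sequentially. \<omega> \<in> space M - A n"
    by (intro borel_cantelli_AE1) (simp_all add: emeasure_eq_measure)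
  then show ?thesis
  proof eventually_elim
    case (elim \<omega>)
    then show ?case
      by (rule eventually_mono) (auto simp: A_def N_def not_less)
  qed
qed

lemma AE_eventually_has_modulus:
  assumes "1 < q"
  shows "AE \<omega> in M. \<forall>\<^sub>F m in sequentially. has_modulus (q ^ m) ((1 / 2) ^ m) (\<lambda>t. B t \<omega>)"
proof -
  \<comment> \<open>\<open>r < 2\<close> makes the chaining ratio less than 1, and
    \<open>r < q\<close> leaves room for the constants.\<close>
  obtain r where r: "1 < r" "r < min q 2" using dense[of 1 "min q 2"] assms by auto
  let ?\<rho> = "sqrt (r / 2)"
  have \<rho>: "0 < ?\<rho>" "?\<rho> < 1" using r by simp_all
  from AE_eventually_small_dyadic_increments[OF r(1)] continuous_paths show ?thesis
  proof eventually_elim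
    case (elim \<omega>)
    let ?h = "\<lambda>t. B t \<omega>"
    let ?inc = "\<lambda>n k. norm (?h (real (Suc k) / 2 ^ n) - ?h (real k / 2 ^ n))"
    have cont: "continuous_on {0..1} ?h" using elim(2) by (rule continuous_on_subset) auto
    have "bounded (?h ` {0..1})"
      using compact_continuous_image[OF cont] by (simp add: compact_imp_bounded)
    then obtain b where b: "0 < b" "\<And>t. t \<in> {0..1} \<Longrightarrow> norm (?h t) \<le> b"
      by (auto simp: bounded_pos)
    obtain n0 where n0: "\<And>n k. n0 \<le> n \<Longrightarrow> k < 2 ^ n \<Longrightarrow> ?inc n k \<le> ?\<rho> ^ n"
      using elim(1) unfolding eventually_sequentially by blast
    \<comment> \<open>The second entry covers the finitely many levels below \<open>n0\<close>,
      where only the bound \<open>b\<close> of the path is available.\<close>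
    define C where "C = max 1 (2 * b / ?\<rho> ^ n0)"
    have "?inc n k \<le> C * ?\<rho> ^ n" if "k < 2 ^ n" for n k
    proof (cases "n0 \<le> n")
      case True
      have "1 * ?\<rho> ^ n \<le> C * ?\<rho> ^ n" unfolding C_def using \<rho>(1) by (intro mult_right_mono) simp_all
      with n0[OF True that] show ?thesis by simp
    next
      case False
      have "real (Suc k) \<le> real (2 ^ n)" using that by (intro of_nat_mono) simp
      then have "real (Suc k) / 2 ^ n \<in> {0..1}" "real k / 2 ^ n \<in> {0..1}"
        using that by simp_all
      from b(2)[OF this(1)] b(2)[OF this(2)] have "?inc n k \<le> 2 * b"
        using norm_triangle_ineq4[of "?h (real (Suc k) / 2 ^ n)" "?h (real k / 2 ^ n)"] by linarith
      also have "\<dots> = 2 * b / ?\<rho> ^ n0 * ?\<rho> ^ n0" using \<rho>(1) by simp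
      also have "\<dots> \<le> C * ?\<rho> ^ n"
        using False \<rho> b(1) unfolding C_def by (intro mult_mono power_decreasing) simp_all
      finally show ?thesis .
    qed
    then show ?case
      using r by (intro has_modulus_if_dyadic_increments[OF cont r(1), of q C]) simp_all
  qed
qed

lemma prob_near_le:
  assumes "0 \<le> s" "0 \<le> t" "s \<noteq> t" "0 \<le> \<epsilon>"
  shows "prob {\<omega> \<in> space M. norm ((B s \<omega> + f s) - (B t \<omega> + f t)) \<le> \<epsilon>} \<le> (\<epsilon> / sqrt \<bar>s - t\<bar>) ^ CARD('d)"
proof (cases "s < t")
  case True
  have "(B s \<omega> + f s) - (B t \<omega> + f t) = - (B t \<omega> - B s \<omega> + (f t - f s))" for \<omega> by simp
  then have "norm ((B s \<omega> + f s) - (B t \<omega> + f t)) = norm (B t \<omega> - B s \<omega> + (f t - f s))" for \<omega>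
    by (simp only: norm_minus_cancel)
  with prob_increment_ball_le[OF assms(1) True assms(4), of "f t - f s"] True show ?thesis by simp
next
  case False
  with assms(3) have "t < s" by simp
  have eq: "(B s \<omega> + f s) - (B t \<omega> + f t) = B s \<omega> - B t \<omega> + (f s - f t)" for \<omega> by simp
  show ?thesis
    unfolding eq using prob_increment_ball_le[OF assms(2) \<open>t < s\<close> assms(4), of "f s - f t"] \<open>t < s\<close> by simp
qed

text \<open>If \<open>s\<close> is the distance in time, the bound \<open>norm (g i - g j) \<le> 2 * L * max \<epsilon> (sqrt s)\<close> turns the
  probability \<open>(\<epsilon> / sqrt s) ^ d\<close> into a power of \<open>\<epsilon> / norm (g i - g j)\<close>, which is summable up to a
  logarithm because the values of \<open>g\<close> are separated.\<close>

lemma sum_prob_near_le: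
  fixes f g :: "real \<Rightarrow> real ^ 'd"
  assumes T: "finite T" "T \<subseteq> {0..1}" "i \<in> T"
    and sep: "separated (2 * \<epsilon>) ((\<lambda>t. (t, g t)) ` T)"
    and \<epsilon>: "\<epsilon> = (1 / 2) ^ m" and L: "1 \<le> L" "L \<le> 2 ^ m"
  shows "(\<Sum>j | j \<in> T \<and> \<bar>i - j\<bar> \<le> \<epsilon> / 2 \<and> norm (g i - g j) \<le> 2 * L * max \<epsilon> (sqrt \<bar>i - j\<bar>).
      prob {\<omega> \<in> space M. norm ((B i \<omega> + f i) - (B j \<omega> + f j)) \<le> \<epsilon>})
    \<le> 1 + 2 * real (Suc m) * (10 * L) ^ CARD('d)"
proof -
  let ?N = "\<lambda>j. {\<omega> \<in> space M. norm ((B i \<omega> + f i) - (B j \<omega> + f j)) \<le> \<epsilon>}"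
  define R where "R = {j \<in> T. \<bar>i - j\<bar> \<le> \<epsilon> / 2 \<and> norm (g i - g j) \<le> 2 * L * max \<epsilon> (sqrt \<bar>i - j\<bar>)}"
  \<comment> \<open>The diagonal pair is always close; it accounts for the summand 1 in the
    bound.\<close>
  define J where "J = R - {i}"
  have "0 < \<epsilon>" "\<epsilon> \<le> 1" unfolding \<epsilon> by (simp_all add: power_le_one)
  have "finite R" using T(1) unfolding R_def by simp
  have J: "j \<in> T" "j \<noteq> i" "\<bar>i - j\<bar> \<le> \<epsilon> / 2" "norm (g i - g j) \<le> 2 * L * max \<epsilon> (sqrt \<bar>i - j\<bar>)"
    if "j \<in> J" for j using that unfolding J_def R_def by simp_all
  \<comment> \<open>Both times are within \<open>\<epsilon> / 2\<close> of \<open>i\<close>, hence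
    within \<epsilon> of each other, so the separation of the graph passes to the values of
    \<open>g\<close>.\<close>
  have far: "\<epsilon> \<le> norm (g j - g k)" if "j \<in> J" "k \<in> J" "j \<noteq> k" for j k
  proof (rule separated_graph[OF sep _ _ that(3)])
    show "\<bar>j - k\<bar> \<le> \<epsilon>" using J(3)[OF that(1)] J(3)[OF that(2)] by linarith
  qed (use that J(1) in auto)
  have far_i: "\<epsilon> \<le> norm (g i - g j)" if "j \<in> J" for j
    using separated_graph[OF sep T(3) J(1)[OF that] J(2)[OF that, symmetric]] J(3)[OF that] \<open>0 < \<epsilon>\<close> by simp
  have "inj_on g J"
  proof (rule inj_onI, rule ccontr)
    fix j k assume "j \<in> J" "k \<in> J" "g j = g k" "j \<noteq> k"
    with far[of j k] \<open>0 < \<epsilon>\<close> show False by simp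
  qed
  have bound: "prob (?N j) \<le> (2 * L) ^ CARD('d) * (\<epsilon> / norm (g i - g j)) ^ CARD('d)" if "j \<in> J" for j
  proof -
    have pos: "0 < norm (g i - g j)" using far_i[OF that] \<open>0 < \<epsilon>\<close> by linarith
    have "prob (?N j) \<le> (2 * L * (\<epsilon> / norm (g i - g j))) ^ CARD('d)"
    \<comment> \<open>For very close times the right-hand side is at least 1, so the trivial bound
      on a probability is enough.\<close>
    proof (cases "sqrt \<bar>i - j\<bar> \<le> \<epsilon>")
      case True
      with J(4)[OF that] have "norm (g i - g j) \<le> 2 * L * \<epsilon>" by simp
      then have "1 \<le> 2 * L * (\<epsilon> / norm (g i - g j))" using pos by simp
      then have "1 \<le> (2 * L * (\<epsilon> / norm (g i - g j))) ^ CARD('d)" by (rule one_le_power)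
      then show ?thesis using prob_le_1[of "?N j"] by linarith
    next
      case False
      then have "0 < sqrt \<bar>i - j\<bar>" using \<open>0 < \<epsilon>\<close> by linarith
      have "norm (g i - g j) \<le> 2 * L * sqrt \<bar>i - j\<bar>" using J(4)[OF that] False by simp
      then have "norm (g i - g j) / (norm (g i - g j) * sqrt \<bar>i - j\<bar>)
          \<le> 2 * L * sqrt \<bar>i - j\<bar> / (norm (g i - g j) * sqrt \<bar>i - j\<bar>)"
        using pos \<open>0 < sqrt \<bar>i - j\<bar>\<close> by (intro divide_right_mono) simp_all
      then have "1 / sqrt \<bar>i - j\<bar> \<le> 2 * L / norm (g i - g j)"
        using pos \<open>0 < sqrt \<bar>i - j\<bar>\<close> by simp
      from mult_left_mono[OF this, of \<epsilon>]
      have "\<epsilon> / sqrt \<bar>i - j\<bar> \<le> 2 * L * (\<epsilon> / norm (g i - g j))"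
        using \<open>0 < \<epsilon>\<close> by (simp add: mult.commute)
      then have "(\<epsilon> / sqrt \<bar>i - j\<bar>) ^ CARD('d) \<le> (2 * L * (\<epsilon> / norm (g i - g j))) ^ CARD('d)"
        using \<open>0 < \<epsilon>\<close> by (intro power_mono) simp_all
      moreover have "prob (?N j) \<le> (\<epsilon> / sqrt \<bar>i - j\<bar>) ^ CARD('d)"
        using J(1,2)[OF that] T(2,3) \<open>0 < \<epsilon>\<close> by (intro prob_near_le) auto
      ultimately show ?thesis by linarith
    qed
    then show ?thesis by (simp only: power_mult_distrib)
  qed
  have "(\<Sum>j\<in>J. prob (?N j)) \<le> (\<Sum>j\<in>J. (2 * L) ^ CARD('d) * (\<epsilon> / norm (g i - g j)) ^ CARD('d))"
    by (rule sum_mono) (rule bound)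
  also have "\<dots> = (2 * L) ^ CARD('d) * (\<Sum>y\<in>g ` J. (\<epsilon> / norm (g i - y)) ^ CARD('d))"
    using \<open>inj_on g J\<close> by (simp add: sum.reindex sum_distrib_left)
  \<comment> \<open>The number of shells: the values lie within \<open>2 * L\<close> of
    \<open>g i\<close>, and \<open>2 * L < 4 * 2 ^ m = 2 ^ (2 * m + 2) * \<epsilon>\<close>.\<close>
  also have "\<dots> \<le> (2 * L) ^ CARD('d) * (real (2 * m + 2) * 5 ^ CARD('d))"
  proof (rule mult_left_mono)
    have "separated \<epsilon> (g ` J)"
      unfolding separated_def using far by (auto simp: dist_norm)
    moreover have "\<epsilon> \<le> norm (g i - y) \<and> norm (g i - y) < 2 ^ (2 * m + 2) * \<epsilon>" if y: "y \<in> g ` J" for y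
    proof -
      obtain j where j: "j \<in> J" "y = g j" using y by blast
      have "sqrt \<bar>i - j\<bar> \<le> 1" using J(3)[OF j(1)] \<open>\<epsilon> \<le> 1\<close> by simp
      then have "2 * L * max \<epsilon> (sqrt \<bar>i - j\<bar>) \<le> 2 * L * 1"
        using \<open>\<epsilon> \<le> 1\<close> L(1) by (intro mult_left_mono) simp_all
      with J(4)[OF j(1)] have "norm (g i - g j) \<le> 2 * L * 1" by (rule order_trans)
      also have "\<dots> < 4 * 2 ^ m"
      proof -
        have "(0::real) < 2 ^ m" by simp
        with L(2) show ?thesis by linarith
      qed
      also have "\<dots> = 2 ^ (2 * m + 2) * \<epsilon>"
      proof -
        have "2 ^ m * \<epsilon> = 1" unfolding \<epsilon> power_mult_distrib[symmetric] by simp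
        moreover have "2 ^ (2 * m + 2) * \<epsilon> = 4 * 2 ^ m * (2 ^ m * \<epsilon>)"
          unfolding mult_2[of m] power_add by simp
        ultimately show ?thesis by (simp only: mult_1_right)
      qed
      finally show ?thesis using far_i[OF j(1)] j(2) by simp
    qed
    ultimately have "(\<Sum>y\<in>g ` J. (\<epsilon> / norm (g i - y)) ^ DIM(real ^ 'd)) \<le> real (2 * m + 2) * 5 ^ DIM(real ^ 'd)"
      using \<open>0 < \<epsilon>\<close> by (intro sum_inverse_distance_power_le)
    then show "(\<Sum>y\<in>g ` J. (\<epsilon> / norm (g i - y)) ^ CARD('d)) \<le> real (2 * m + 2) * 5 ^ CARD('d)" by simp
  qed (use L in simp)
  also have "\<dots> = 2 * real (Suc m) * ((2 * L) ^ CARD('d) * 5 ^ CARD('d))" by simp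
  also have "(2 * L) ^ CARD('d) * 5 ^ CARD('d) = (10 * L) ^ CARD('d)"
    unfolding power_mult_distrib[symmetric] by simp
  finally have le: "(\<Sum>j\<in>J. prob (?N j)) \<le> 2 * real (Suc m) * (10 * L) ^ CARD('d)" .
  have "(\<Sum>j\<in>R. prob (?N j)) \<le> (\<Sum>j\<in>insert i J. prob (?N j))"
    using \<open>finite R\<close> unfolding J_def by (intro sum_mono2) auto
  also have "\<dots> = prob (?N i) + (\<Sum>j\<in>J. prob (?N j))"
    using \<open>finite R\<close> unfolding J_def by (subst sum.insert) simp_all
  also have "\<dots> \<le> 1 + 2 * real (Suc m) * (10 * L) ^ CARD('d)"
    using prob_le_1[of "?N i"] le by linarith
  finally show ?thesis unfolding R_def .
qed

text \<open>Markov's inequality for the number \<open>Z\<close> of near pairs, whose expectation is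
  bounded by summing \<open>sum_prob_near_le\<close> over \<open>i\<close>.\<close>

lemma prob_many_near_pairs_le:
  fixes f g :: "real \<Rightarrow> real ^ 'd"
  assumes T: "finite T" "T \<subseteq> {0..1}"
    and sep: "separated (2 * \<epsilon>) ((\<lambda>t. (t, g t)) ` T)"
    and \<epsilon>: "\<epsilon> = (1 / 2) ^ m" and L: "1 \<le> L" "L \<le> 2 ^ m" and "0 < a"
  defines "E \<equiv> {\<omega> \<in> space M. a * real (card T) < real (card (near_pairs \<epsilon> L g (\<lambda>t. B t \<omega> + f t) T))}"
  shows "E \<in> sets M" "prob E \<le> (1 + 2 * real (Suc m) * (10 * L) ^ CARD('d)) / a"
proof -
  let ?K = "1 + 2 * real (Suc m) * (10 * L) ^ CARD('d)"
  define N where "N i j = {\<omega> \<in> space M. norm ((B i \<omega> + f i) - (B j \<omega> + f j)) \<le> \<epsilon>}" for i j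
  define R where "R i = {j \<in> T. \<bar>i - j\<bar> \<le> \<epsilon> / 2 \<and> norm (g i - g j) \<le> 2 * L * max \<epsilon> (sqrt \<bar>i - j\<bar>)}" for i
  define Z where "Z \<omega> = (\<Sum>i\<in>T. \<Sum>j\<in>R i. indicator (N i j) \<omega> :: real)" for \<omega>
  have fin: "finite (R i)" for i using T(1) unfolding R_def by simp
  have N_sets: "N i j \<in> sets M" if "i \<in> T" "j \<in> R i" for i j
  proof -
    have "0 \<le> i" "0 \<le> j" using that T(2) unfolding R_def by auto
    then have [measurable]: "B i \<in> borel_measurable M" "B j \<in> borel_measurable M"
      by (simp_all add: measurable_B)
    show ?thesis unfolding N_def by measurable
  qed
  have card_eq: "real (card (near_pairs \<epsilon> L g (\<lambda>t. B t \<omega> + f t) T)) = Z \<omega>" if "\<omega> \<in> space M" for \<omega>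
  proof -
    have "near_pairs \<epsilon> L g (\<lambda>t. B t \<omega> + f t) T = (SIGMA i:T. {j \<in> R i. \<omega> \<in> N i j})"
      unfolding near_pairs_def R_def N_def using that by auto
    then have "card (near_pairs \<epsilon> L g (\<lambda>t. B t \<omega> + f t) T) = (\<Sum>i\<in>T. card {j \<in> R i. \<omega> \<in> N i j})"
      using T(1) fin by simp
    moreover have "real (card {j \<in> R i. \<omega> \<in> N i j}) = (\<Sum>j\<in>R i. indicator (N i j) \<omega>)" for i
    proof -
      have "real (card {j \<in> R i. \<omega> \<in> N i j}) = (\<Sum>j | j \<in> R i \<and> \<omega> \<in> N i j. 1)" by simp
      also have "\<dots> = (\<Sum>j\<in>R i. if \<omega> \<in> N i j then 1 else 0)"
        by (rule sum.inter_filter[OF fin])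
      finally show ?thesis unfolding indicator_def of_bool_def .
    qed
    ultimately show ?thesis unfolding Z_def by simp
  qed
  have int: "integrable M (\<lambda>\<omega>. indicator (N i j) \<omega> :: real)" if "i \<in> T" "j \<in> R i" for i j
    using N_sets[OF that] by (intro integrable_real_indicator) (simp_all add: emeasure_eq_measure)
  have Z_int: "integrable M Z"
    unfolding Z_def by (intro Bochner_Integration.integrable_sum int)
  have Z_nonneg: "0 \<le> Z \<omega>" for \<omega> unfolding Z_def by (intro sum_nonneg) simp
  have E_eq: "E = {\<omega> \<in> space M. a * real (card T) < Z \<omega>}"
    unfolding E_def using card_eq by auto
  show E_sets: "E \<in> sets M"
    unfolding E_eq using borel_measurable_integrable[OF Z_int] by measurable
  have "expectation Z = (\<Sum>i\<in>T. \<Sum>j\<in>R i. prob (N i j))"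
    unfolding Z_def
    by (subst Bochner_Integration.integral_sum,
        use int in \<open>auto intro!: sum.cong Bochner_Integration.integrable_sum simp: Bochner_Integration.integral_sum N_sets\<close>)
  also have "\<dots> \<le> (\<Sum>i\<in>T. ?K)"
    unfolding R_def N_def by (intro sum_mono sum_prob_near_le T sep \<epsilon> L)
  finally have Z_le: "expectation Z \<le> real (card T) * ?K" by simp
  show "prob E \<le> ?K / a"
  proof (cases "T = {}")
    case True
    then have "E = {}" unfolding E_eq Z_def by simp
    then show ?thesis using \<open>0 < a\<close> L by simp
  next
    case False
    then have n: "0 < real (card T)" using T(1) by (simp add: card_gt_0_iff)
    have "prob E \<le> prob {\<omega> \<in> space M. a * real (card T) \<le> Z \<omega>}"
      unfolding E_eq using borel_measurable_integrable[OF Z_int] by (intro finite_measure_mono) auto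
    also have "\<dots> \<le> expectation Z / (a * real (card T))"
      using Z_int Z_nonneg n \<open>0 < a\<close>
      by (intro integral_Markov_inequality_measure[of _ _ "{}"]) simp_all
    also have "\<dots> \<le> real (card T) * ?K / (a * real (card T))"
      using Z_le n \<open>0 < a\<close> by (intro divide_right_mono) simp_all
    also have "\<dots> = ?K / a" using n by simp
    finally show ?thesis .
  qed
qed

text \<open>Borel--Cantelli along the dyadic scales: the exceptional probabilities are of order at
  most \<open>m * (q ^ CARD('d) / \<kappa>) ^ m\<close>, up to a geometric term. The times
  \<open>T m\<close> and functions \<open>g m\<close> are deterministic.\<close>

lemma AE_eventually_few_near_pairs:
  fixes f :: "real \<Rightarrow> real ^ 'd" and g :: "nat \<Rightarrow> real \<Rightarrow> real ^ 'd"
  assumes T: "\<And>m. finite (T m)" "\<And>m. T m \<subseteq> {0..1}"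
    and sep: "\<And>m. separated (2 * (1 / 2) ^ m) ((\<lambda>t. (t, g m t)) ` T m)"
    and q: "1 \<le> q" "q \<le> 2" and \<kappa>: "q ^ CARD('d) < \<kappa>"
  shows "AE \<omega> in M. \<forall>\<^sub>F m in sequentially.
    real (card (near_pairs ((1 / 2) ^ m) (q ^ m) (g m) (\<lambda>t. B t \<omega> + f t) (T m))) \<le> \<kappa> ^ m * real (card (T m))"
proof -
  define E where "E m = {\<omega> \<in> space M. \<kappa> ^ m * real (card (T m)) <
    real (card (near_pairs ((1 / 2) ^ m) (q ^ m) (g m) (\<lambda>t. B t \<omega> + f t) (T m)))}" for m
  have "1 \<le> q ^ CARD('d)" using q(1) by (rule one_le_power)
  with \<kappa> have "1 < \<kappa>" by linarith
  have qm: "1 \<le> q ^ m" "q ^ m \<le> 2 ^ m" for m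
    using q by (simp_all add: one_le_power power_mono)
  have "0 < \<kappa> ^ m" for m using \<open>1 < \<kappa>\<close> by simp
  then have E: "E m \<in> sets M"
    "prob (E m) \<le> (1 + 2 * real (Suc m) * (10 * q ^ m) ^ CARD('d)) / \<kappa> ^ m" for m
    unfolding E_def
    using prob_many_near_pairs_le[OF T(1) T(2) sep refl qm(1) qm(2), where a = "\<kappa> ^ m" and f = f] by simp_all
  have "summable (\<lambda>m. prob (E m))"
  proof (rule summable_comparison_test')
    let ?x = "q ^ CARD('d) / \<kappa>"
    have x: "norm ?x < 1" using \<kappa> q(1) \<open>1 < \<kappa>\<close> by simp
    have "summable (\<lambda>m. real (Suc m) * ?x ^ m)"
      using geometric_deriv_sums[OF x] by (simp add: sums_iff)
    then show "summable (\<lambda>m. (1 / \<kappa>) ^ m + 2 * 10 ^ CARD('d) * (real (Suc m) * ?x ^ m))"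
      using \<open>1 < \<kappa>\<close> by (intro summable_add summable_mult summable_geometric) simp_all
    fix m
    have "(10 * q ^ m) ^ CARD('d) = 10 ^ CARD('d) * (q ^ CARD('d)) ^ m"
      by (simp only: power_mult_distrib power_mult[symmetric] mult.commute[of m])
    then have "(1 + 2 * real (Suc m) * (10 * q ^ m) ^ CARD('d)) / \<kappa> ^ m
        = (1 / \<kappa>) ^ m + 2 * 10 ^ CARD('d) * (real (Suc m) * ?x ^ m)"
      by (simp add: add_divide_distrib power_divide del: of_nat_Suc)
    then show "norm (prob (E m)) \<le> (1 / \<kappa>) ^ m + 2 * 10 ^ CARD('d) * (real (Suc m) * ?x ^ m)"
      using E(2)[of m] by simp
  qed
  then have "AE \<omega> in M. \<forall>\<^sub>F m in sequentially. \<omega> \<in> space M - E m"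
    using E(1) by (intro borel_cantelli_AE1) (simp_all add: emeasure_eq_measure)
  then show ?thesis
  proof eventually_elim
    case (elim \<omega>)
    then show ?case by (rule eventually_mono) (auto simp: E_def not_less)
  qed
qed

end

section \<open>Minkowski dimensions of graphs\<close>

text \<open>A factor \<open>\<kappa> ^ m\<close> at scale \<open>(1 / 2) ^ m\<close> is a small
  power of \<open>1 / \<epsilon>\<close>, hence a small additive error in the quotient. General
  radii are reached by monotonicity and \<open>packing_number_scale\<close>.\<close>

lemma eventually_minkowski_quotient_le:
  fixes E :: "'a::euclidean_space set" and F :: "'b::euclidean_space set"
  assumes E: "bounded E" "E \<noteq> {}" and F: "bounded F" "F \<noteq> {}" and c: "0 < c"
    and le: "\<And>\<kappa>. 1 < \<kappa> \<Longrightarrow> \<forall>\<^sub>F m in sequentially.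
      real (packing_number E ((1 / 2) ^ m)) \<le> \<kappa> ^ m * real (packing_number F (c * (1 / 2) ^ m))"
    and "0 < \<delta>"
  shows "\<forall>\<^sub>F \<epsilon> in at_right 0. ln (real (packing_number E \<epsilon>)) / ln (inverse \<epsilon>)
    \<le> ln (real (packing_number F \<epsilon>)) / ln (inverse \<epsilon>) + \<delta>"
proof -
  \<comment> \<open>Two of the four parts pay for the factor \<open>exp \<theta> ^ n\<close>, as
    \<open>n \<le> 2 * l\<close>; the other two absorb \<open>\<theta> + ln C\<close>, which is
    possible once \<open>l\<close> exceeds \<open>W\<close>.\<close>
  define \<theta> where "\<theta> = \<delta> / 4"
  have "0 < \<theta>" using \<open>0 < \<delta>\<close> unfolding \<theta>_def by simp
  define C where "C = (1 + 2 / (c / 2)) ^ DIM('b)"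
  have "1 \<le> C" unfolding C_def using c by (intro one_le_power) simp
  have "\<forall>\<^sub>F m in sequentially.
      real (packing_number E ((1 / 2) ^ m)) \<le> exp \<theta> ^ m * real (packing_number F (c * (1 / 2) ^ m))"
    using \<open>0 < \<theta>\<close> by (intro le) simp
  then obtain N where N: "\<And>m. N \<le> m \<Longrightarrow>
      real (packing_number E ((1 / 2) ^ m)) \<le> exp \<theta> ^ m * real (packing_number F (c * (1 / 2) ^ m))"
    unfolding eventually_sequentially by blast
  define W where "W = max 1 ((\<theta> + ln C) / (2 * \<theta>))"
  have "0 < min ((1 / 2) ^ N) (exp (- W))" by simp
  from eventually_at_right_real[OF this] show ?thesis
  proof eventually_elim
    case (elim \<epsilon>)
    then have \<epsilon>: "0 < \<epsilon>" "\<epsilon> < (1 / 2) ^ N" "\<epsilon> < exp (- W)" by auto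
    define l where "l = ln (inverse \<epsilon>)"
    have "ln \<epsilon> < ln (exp (- W))" using \<epsilon>(1,3) by (subst ln_less_cancel_iff) simp_all
    then have "W < l" unfolding l_def using \<epsilon>(1) by (simp add: ln_inverse)
    then have "1 < l" "(\<theta> + ln C) / (2 * \<theta>) < l" unfolding W_def by simp_all
    then have slack: "\<theta> + ln C < 2 * \<theta> * l"
      using \<open>0 < \<theta>\<close> by (simp add: pos_divide_less_eq mult.commute)
    have "exp (- W) < 1" unfolding W_def by simp
    with \<epsilon> have "\<epsilon> \<le> 1" by linarith
    with \<epsilon>(1) obtain n where n: "(1 / 2) ^ Suc n < \<epsilon>" "\<epsilon> \<le> (1 / 2) ^ n"
      by (rule dyadic_scale)
    have "N \<le> Suc n"
    proof (rule ccontr)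
      assume "\<not> N \<le> Suc n"
      then have "(1 / 2 :: real) ^ N \<le> (1 / 2) ^ Suc n" by (intro power_decreasing) simp_all
      with n(1) \<epsilon>(2) show False by linarith
    qed
    have "real n \<le> 2 * l"
    proof -
      have "ln \<epsilon> \<le> ln ((1 / 2) ^ n)" using n(2) \<epsilon>(1) by (subst ln_le_cancel_iff) simp_all
      also have "\<dots> = - (real n * ln 2)" by (simp add: ln_realpow ln_div)
      finally have "real n * ln 2 \<le> l" unfolding l_def using \<epsilon>(1) by (simp add: ln_inverse)
      moreover have "real n * (1 / 2) \<le> real n * ln 2"
      proof (rule mult_left_mono)
        have "1 - 1 / 2 \<le> ln (2 :: real)" using ln_le_minus_one[of "1 / 2 :: real"]
          by (simp add: ln_div)
        then show "1 / 2 \<le> ln (2 :: real)" by simp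
      qed simp
      ultimately show ?thesis by linarith
    qed
    have "real (packing_number E \<epsilon>) \<le> real (packing_number E ((1 / 2) ^ Suc n))"
      using n(1) by (intro of_nat_mono packing_number_antimono E(1)) simp_all
    also have "\<dots> \<le> exp \<theta> ^ Suc n * real (packing_number F (c * (1 / 2) ^ Suc n))"
      using \<open>N \<le> Suc n\<close> by (rule N)
    also have "\<dots> \<le> exp \<theta> ^ Suc n * (C * real (packing_number F \<epsilon>))"
    proof (rule mult_left_mono)
      \<comment> \<open>The set \<open>E\<close> was compared at the next finer dyadic scale, which
        costs the factor \<open>1 / 2\<close> here.\<close>
      have "c / 2 * \<epsilon> \<le> c / 2 * (1 / 2) ^ n" using n(2) c by (intro mult_left_mono) simp_all
      then have "c / 2 * \<epsilon> \<le> c * (1 / 2) ^ Suc n" by simp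
      then have "real (packing_number F (c * (1 / 2) ^ Suc n)) \<le> real (packing_number F (c / 2 * \<epsilon>))"
        using c \<epsilon>(1) by (intro of_nat_mono packing_number_antimono F(1)) simp_all
      also have "\<dots> \<le> C * real (packing_number F \<epsilon>)"
        unfolding C_def using c \<epsilon>(1) by (intro packing_number_scale F(1)) simp_all
      finally show "real (packing_number F (c * (1 / 2) ^ Suc n)) \<le> C * real (packing_number F \<epsilon>)" .
    qed simp
    finally have bound: "real (packing_number E \<epsilon>) \<le> exp \<theta> ^ Suc n * (C * real (packing_number F \<epsilon>))" .
    have pos: "0 < real (packing_number E \<epsilon>)" "0 < real (packing_number F \<epsilon>)"
      using packing_number_pos[OF E(1) \<epsilon>(1) E(2)] packing_number_pos[OF F(1) \<epsilon>(1) F(2)] by simp_all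
    have "ln (real (packing_number E \<epsilon>)) \<le> ln (exp \<theta> ^ Suc n * (C * real (packing_number F \<epsilon>)))"
      using bound pos(1) order_less_le_trans[OF pos(1) bound] by (simp only: ln_le_cancel_iff)
    also have "\<dots> = real (Suc n) * \<theta> + (ln C + ln (real (packing_number F \<epsilon>)))"
      using pos(2) \<open>1 \<le> C\<close> by (simp add: ln_mult ln_realpow del: power_Suc of_nat_Suc)
    also have "\<dots> \<le> ln (real (packing_number F \<epsilon>)) + \<delta> * l"
    proof -
      have "real n * \<theta> \<le> 2 * l * \<theta>"
        using \<open>real n \<le> 2 * l\<close> \<open>0 < \<theta>\<close> by (intro mult_right_mono) simp_all
      then have "real (Suc n) * \<theta> \<le> \<theta> + 2 * \<theta> * l" by (simp add: algebra_simps)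
      moreover have "\<delta> * l = 2 * \<theta> * l + 2 * \<theta> * l" unfolding \<theta>_def by simp
      ultimately show ?thesis using slack by linarith
    qed
    finally have "ln (real (packing_number E \<epsilon>)) / l \<le> (ln (real (packing_number F \<epsilon>)) + \<delta> * l) / l"
      using \<open>1 < l\<close> by (intro divide_right_mono) simp_all
    also have "\<dots> = ln (real (packing_number F \<epsilon>)) / l + \<delta>"
      using \<open>1 < l\<close> by (simp add: add_divide_distrib)
    finally show ?case unfolding l_def .
  qed
qed

text \<open>The quotients are compared pointwise up to an arbitrary \<delta>, so upper and lower
  limits are treated alike.\<close>

lemma minkowski_dim_le:
  fixes E :: "'a::euclidean_space set" and F :: "'b::euclidean_space set"
  assumes "bounded E" "E \<noteq> {}" "bounded F" "F \<noteq> {}" "0 < c"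
    and "\<And>\<kappa>. 1 < \<kappa> \<Longrightarrow> \<forall>\<^sub>F m in sequentially.
      real (packing_number E ((1 / 2) ^ m)) \<le> \<kappa> ^ m * real (packing_number F (c * (1 / 2) ^ m))"
  shows "upper_minkowski_dim E \<le> upper_minkowski_dim F"
    and "lower_minkowski_dim E \<le> lower_minkowski_dim F"
proof -
  let ?u = "\<lambda>\<epsilon>. ereal (ln (real (packing_number E \<epsilon>)) / ln (inverse \<epsilon>))"
  let ?v = "\<lambda>\<epsilon>. ereal (ln (real (packing_number F \<epsilon>)) / ln (inverse \<epsilon>))"
  have ev: "\<forall>\<^sub>F \<epsilon> in at_right 0. ?u \<epsilon> \<le> ?v \<epsilon> + ereal \<delta>" if "0 < \<delta>" for \<delta>
    using eventually_minkowski_quotient_le[OF assms that] by simp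
  have nb: "at_right (0::real) \<noteq> bot" by simp
  show "upper_minkowski_dim E \<le> upper_minkowski_dim F"
    unfolding upper_minkowski_dim_def
  proof (rule ereal_le_epsilon2)
    fix \<delta> :: real assume "0 < \<delta>"
    from Limsup_mono[OF ev[OF this]]
    show "Limsup (at_right 0) ?u \<le> Limsup (at_right 0) ?v + ereal \<delta>"
      by (subst (asm) Limsup_add_ereal_right[OF nb]) simp_all
  qed
  show "lower_minkowski_dim E \<le> lower_minkowski_dim F"
    unfolding lower_minkowski_dim_def
  proof (rule ereal_le_epsilon2)
    fix \<delta> :: real assume "0 < \<delta>"
    from Liminf_mono[OF ev[OF this]]
    show "Liminf (at_right 0) ?u \<le> Liminf (at_right 0) ?v + ereal \<delta>"
      by (subst (asm) Liminf_add_ereal_right[OF nb]) simp_all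
  qed
qed

section \<open>Graphs over subsets of the unit interval and their packings\<close>

lemma graph_over_eq_image: "graph_over A h = (\<lambda>t. (t, h t)) ` A"
  unfolding graph_over_def by auto

lemma bounded_graph_over:
  fixes h :: "real \<Rightarrow> 'a::real_normed_vector"
  assumes "A \<subseteq> {0..1}" "bounded (h ` {0..1})"
  shows "bounded (graph_over A h)"
proof (rule bounded_subset)
  show "bounded ({0..1::real} \<times> h ` {0..1})" using assms(2) by (intro bounded_Times) simp_all
  show "graph_over A h \<subseteq> {0..1} \<times> h ` {0..1}" unfolding graph_over_eq_image using assms(1) by auto
qed

text \<open>One-sided limits make \<open>f\<close> bounded near every point, and bisection passes
  from local to global boundedness.\<close>

lemma cadlag_on_bounded:
  fixes f :: "real \<Rightarrow> 'a::real_normed_vector"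
  assumes "cadlag_on a b f" "a \<le> b"
  shows "bounded (f ` {a..b})"
proof -
  have "bounded (f ` ({a..b} \<inter> {a..b}))"
    using assms(2)
  proof (induction rule: Bolzano[where P = "\<lambda>u v. bounded (f ` ({a..b} \<inter> {u..v}))"])
    case (trans u v w)
    have "f ` ({a..b} \<inter> {u..w}) \<subseteq> f ` (({a..b} \<inter> {u..v}) \<union> ({a..b} \<inter> {v..w}))"
      by (intro image_mono) auto
    moreover have "bounded (f ` (({a..b} \<inter> {u..v}) \<union> ({a..b} \<inter> {v..w})))"
      unfolding image_Un bounded_Un using trans(1,2) by blast
    ultimately show ?case by (rule bounded_subset[rotated])
  next
    case (local x)
    obtain d1 l where d1: "0 < d1" "\<And>y. x < y \<Longrightarrow> y < x + d1 \<Longrightarrow> y \<le> b \<Longrightarrow> f y \<in> ball l 1"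
    proof (cases "x < b")
      case True
      then have "(f \<longlongrightarrow> f x) (at_right x)" using assms(1) local(1) unfolding cadlag_on_def by auto
      then have "\<forall>\<^sub>F y in at_right x. dist (f y) (f x) < 1" by (rule tendstoD) simp
      then obtain e where e: "x < e" "\<forall>y>x. y < e \<longrightarrow> dist (f y) (f x) < 1"
        unfolding eventually_at_right_field by blast
      show ?thesis
      proof (rule that)
        show "0 < e - x" using e(1) by simp
        fix y assume "x < y" "y < x + (e - x)"
        then have "dist (f y) (f x) < 1" using e(2) by simp
        then show "f y \<in> ball (f x) 1" by (simp add: dist_commute)
      qed
    next
      case False
      then show ?thesis by (intro that[of 1]) simp_all
    qed
    obtain d2 l' where d2: "0 < d2" "\<And>y. y < x \<Longrightarrow> x - d2 < y \<Longrightarrow> a \<le> y \<Longrightarrow> f y \<in> ball l' 1"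
    proof (cases "a < x")
      case True
      then have "\<exists>l'. (f \<longlongrightarrow> l') (at_left x)" using assms(1) local(2) unfolding cadlag_on_def by simp
      then obtain l' where "(f \<longlongrightarrow> l') (at_left x)" by blast
      then have "\<forall>\<^sub>F y in at_left x. dist (f y) l' < 1" by (rule tendstoD) simp
      then obtain e where e: "e < x" "\<forall>y>e. y < x \<longrightarrow> dist (f y) l' < 1"
        unfolding eventually_at_left_field by blast
      show ?thesis
      proof (rule that)
        show "0 < x - e" using e(1) by simp
        fix y assume "y < x" "x - (x - e) < y"
        then have "dist (f y) l' < 1" using e(2) by simp
        then show "f y \<in> ball l' 1" by (simp add: dist_commute)
      qed
    next
      case False
      then show ?thesis by (intro that[of 1]) simp_all
    qed
    show ?case
    proof (intro exI[of _ "min d1 d2"] conjI allI impI)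
      show "0 < min d1 d2" using d1(1) d2(1) by simp
      fix u v assume uv: "u \<le> x \<and> x \<le> v \<and> v - u < min d1 d2"
      \<comment> \<open>The one-sided limits say nothing about the value at \<open>x\<close> itself,
        so it is listed separately.\<close>
      have "f ` ({a..b} \<inter> {u..v}) \<subseteq> ball l 1 \<union> ball l' 1 \<union> {f x}"
      proof
        fix z assume "z \<in> f ` ({a..b} \<inter> {u..v})"
        then obtain y where y: "a \<le> y" "y \<le> b" "u \<le> y" "y \<le> v" "z = f y" by auto
        consider "y < x" | "y = x" | "x < y" by linarith
        then show "z \<in> ball l 1 \<union> ball l' 1 \<union> {f x}"
        proof cases
          case 1
          then show ?thesis using d2(2)[of y] uv y by simp
        next
          case 2
          then show ?thesis using y by simp
        next
          case 3
          then show ?thesis using d1(2)[of y] uv y by simp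
        qed
      qed
      then show "bounded (f ` ({a..b} \<inter> {u..v}))"
        by (rule bounded_subset[rotated]) simp
    qed
  qed
  then show ?thesis by simp
qed

text \<open>A graph projects injectively onto its times, so an optimal packing can be recorded as a
  set of times.\<close>

lemma packing_number_graph_attained:
  fixes h :: "real \<Rightarrow> 'a::euclidean_space"
  assumes "bounded (graph_over A h)" "0 < \<epsilon>"
  obtains T where "finite T" "T \<subseteq> A" "separated (2 * \<epsilon>) ((\<lambda>t. (t, h t)) ` T)"
    "card T = packing_number (graph_over A h) \<epsilon>"
proof -
  obtain C where C: "finite C" "C \<subseteq> graph_over A h" "separated (2 * \<epsilon>) C"
      "card C = packing_number (graph_over A h) \<epsilon>"
    using packing_number_attained[OF assms] .
  have "inj_on fst (graph_over A h)" unfolding graph_over_def by (auto intro!: inj_onI)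
  then have "inj_on fst C" using C(2) by (rule inj_on_subset)
  have eq: "(\<lambda>t. (t, h t)) ` fst ` C = C"
    using C(2) unfolding graph_over_def by force
  show ?thesis
  proof (rule that[of "fst ` C"])
    show "finite (fst ` C)" using C(1) by simp
    show "fst ` C \<subseteq> A" using C(2) unfolding graph_over_def by auto
    show "separated (2 * \<epsilon>) ((\<lambda>t. (t, h t)) ` fst ` C)" unfolding eq by (rule C(3))
    show "card (fst ` C) = packing_number (graph_over A h) \<epsilon>"
      using card_image[OF \<open>inj_on fst C\<close>] C(4) by simp
  qed
qed

text \<open>With radius \<open>\<epsilon> / 8\<close> the Cauchy--Schwarz bound concerns graph
  points closer than \<open>\<epsilon> / 2\<close>. By \<open>imp\<close>, such pairs also satisfy
  the condition on \<open>g\<close>, so all of them are counted by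
  \<open>near_pairs\<close>.\<close>

lemma card_times_le_packing_number:
  fixes g X :: "real \<Rightarrow> 'a::euclidean_space"
  assumes "bounded (graph_over A X)" "0 < \<epsilon>" "finite T" "T \<subseteq> A" "0 \<le> K"
    and few: "real (card (near_pairs \<epsilon> L g X T)) \<le> K * real (card T)"
    and imp: "\<And>i j. i \<in> T \<Longrightarrow> j \<in> T \<Longrightarrow> norm (X i - X j) \<le> \<epsilon> \<Longrightarrow>
      norm (g i - g j) \<le> 2 * L * max \<epsilon> (sqrt \<bar>i - j\<bar>)"
  shows "real (card T) \<le> K * real (packing_number (graph_over A X) (1 / 8 * \<epsilon>))"
proof (rule card_le_packing_number_of_near_pairs)
  show "(\<lambda>t. (t, X t)) ` T \<subseteq> graph_over A X"
    unfolding graph_over_eq_image using assms(4) by blast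
  have "card {(i, j) \<in> T \<times> T. dist (i, X i) (j, X j) < 4 * (1 / 8 * \<epsilon>)} \<le> card (near_pairs \<epsilon> L g X T)"
  proof (rule card_mono)
    show "finite (near_pairs \<epsilon> L g X T)"
      unfolding near_pairs_def using assms(3) by (intro finite_SigmaI) simp_all
    show "{(i, j) \<in> T \<times> T. dist (i, X i) (j, X j) < 4 * (1 / 8 * \<epsilon>)} \<subseteq> near_pairs \<epsilon> L g X T"
    proof
      fix ij assume "ij \<in> {(i, j) \<in> T \<times> T. dist (i, X i) (j, X j) < 4 * (1 / 8 * \<epsilon>)}"
      then obtain i j where ij: "ij = (i, j)" "i \<in> T" "j \<in> T" "dist (i, X i) (j, X j) < \<epsilon> / 2"
        by auto
      have "dist i j \<le> dist (i, X i) (j, X j)" "dist (X i) (X j) \<le> dist (i, X i) (j, X j)"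
        using dist_fst_le[of "(i, X i)" "(j, X j)"] dist_snd_le[of "(i, X i)" "(j, X j)"] by simp_all
      then have "\<bar>i - j\<bar> \<le> \<epsilon> / 2" "norm (X i - X j) \<le> \<epsilon>"
        using ij(4) \<open>0 < \<epsilon>\<close> by (simp_all add: dist_norm)
      then show "ij \<in> near_pairs \<epsilon> L g X T"
        unfolding near_pairs_def using ij imp[OF ij(2,3)] by simp
    qed
  qed
  then show "real (card {(i, j) \<in> T \<times> T. dist (i, X i) (j, X j) < 4 * (1 / 8 * \<epsilon>)}) \<le> K * real (card T)"
    using few by linarith
qed (use assms in auto)

text \<open>The bound is uniform in \<open>g\<close>, which lets a largest separated set of times be
  chosen over all functions with the given modulus.\<close>

lemma card_separated_graph_le:
  fixes g :: "real \<Rightarrow> 'a::euclidean_space"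
  assumes "has_modulus L \<epsilon> g" "0 \<le> L" "0 < \<epsilon>" "\<epsilon> \<le> 1" "T \<subseteq> {0..1}"
    and sep: "separated (2 * \<epsilon>) ((\<lambda>t. (t, g t)) ` T)"
  shows "real (card T) \<le> (1 + 2 * (1 + L) / (2 * \<epsilon>)) ^ DIM(real \<times> 'a)"
proof -
  have "(\<lambda>t. (t, g t)) ` T \<subseteq> cball (0, g 0) (1 + L)"
  proof
    fix z assume "z \<in> (\<lambda>t. (t, g t)) ` T"
    then obtain t where t: "t \<in> {0..1}" "z = (t, g t)" using assms(5) by auto
    have "(0::real) \<in> {0..1}" by simp
    then have "norm (g 0 - g t) \<le> L * max \<epsilon> (sqrt \<bar>0 - t\<bar>)"
      using assms(1) t(1) unfolding has_modulus_def by blast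
    also have "\<dots> \<le> L * 1"
      using assms(2,4) t(1) by (intro mult_left_mono) simp_all
    finally have "dist (g 0) (g t) \<le> L" by (simp add: dist_norm)
    moreover have "dist 0 t \<le> 1" using t(1) by simp
    moreover have "dist (0, g 0) (t, g t) \<le> dist 0 t + dist (g 0) (g t)"
      unfolding dist_Pair_Pair by (rule sqrt_sum_squares_le_sum) simp_all
    ultimately show "z \<in> cball (0, g 0) (1 + L)" unfolding t(2) by simp
  qed
  from card_separated_le[OF sep this] assms(2,3)
  have "real (card ((\<lambda>t. (t, g t)) ` T)) \<le> (1 + 2 * (1 + L) / (2 * \<epsilon>)) ^ DIM(real \<times> 'a)" by simp
  moreover have "card ((\<lambda>t. (t, g t)) ` T) = card T"
    by (intro card_image inj_onI) simp
  ultimately show ?thesis by simp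
qed

text \<open>The modulus factor \<open>q ^ m\<close> enters the pair count with power
  \<open>d\<close>; this leaves a gap to the admissible loss \<open>\<kappa> ^ m\<close>.\<close>

lemma obtain_base_below:
  fixes \<kappa> :: real
  assumes "1 < \<kappa>" "0 < d"
  obtains q where "1 < q" "q \<le> 2" "q ^ d < \<kappa>"
proof -
  define q where "q = min 2 (root d ((1 + \<kappa>) / 2))"
  have "1 < root d ((1 + \<kappa>) / 2)" using assms by simp
  then have "1 < q" unfolding q_def by simp
  have "q ^ d \<le> root d ((1 + \<kappa>) / 2) ^ d" using \<open>1 < q\<close> unfolding q_def by (intro power_mono) simp_all
  also have "\<dots> = (1 + \<kappa>) / 2" using assms by simp
  also have "\<dots> < \<kappa>" using assms(1) by simp
  finally show ?thesis using that[of q] \<open>1 < q\<close> unfolding q_def by simp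
qed

section \<open>Almost sure comparison of packing numbers\<close>

context standard_brownian_motion
begin

lemma AE_bounded_paths: "AE \<omega> in M. bounded ((\<lambda>t. B t \<omega>) ` {0..1})"
  using continuous_paths
proof eventually_elim
  case (elim \<omega>)
  then have "continuous_on {0..1} (\<lambda>t. B t \<omega>)" by (rule continuous_on_subset) auto
  then show ?case by (intro compact_imp_bounded compact_continuous_image) simp_all
qed

lemma bounded_graph_sum:
  fixes f :: "real \<Rightarrow> real ^ 'd"
  assumes "A \<subseteq> {0..1}" "bounded (f ` {0..1})" "bounded ((\<lambda>t. B t \<omega>) ` {0..1})"
  shows "bounded (graph_over A (\<lambda>t. B t \<omega> + f t))"
  by (intro bounded_graph_over assms bounded_plus_comp)

text \<open>Optimal packings of the graph of \<open>f\<close> have deterministic times, so the pair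
  count applies directly with \<open>g = f\<close>.\<close>

lemma AE_packing_number_drift_le:
  fixes f :: "real \<Rightarrow> real ^ 'd"
  assumes A: "A \<subseteq> {0..1}" and f: "bounded (f ` {0..1})" and "1 < \<kappa>"
  shows "AE \<omega> in M. \<forall>\<^sub>F m in sequentially. real (packing_number (graph_over A f) ((1 / 2) ^ m))
    \<le> \<kappa> ^ m * real (packing_number (graph_over A (\<lambda>t. B t \<omega> + f t)) (1 / 8 * (1 / 2) ^ m))"
proof -
  obtain q where q: "1 < q" "q \<le> 2" "q ^ CARD('d) < \<kappa>"
    using obtain_base_below[OF \<open>1 < \<kappa>\<close>, of "CARD('d)"] by auto
  define P where "P m T \<longleftrightarrow> finite T \<and> T \<subseteq> A \<and> separated (2 * (1 / 2) ^ m) ((\<lambda>t. (t, f t)) ` T) \<and>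
      card T = packing_number (graph_over A f) ((1 / 2) ^ m)" for m T
  have "\<exists>T. P m T" for m
  proof -
    have "0 < (1 / 2 :: real) ^ m" by simp
    from packing_number_graph_attained[OF bounded_graph_over[OF A f] this]
    obtain T where "finite T" "T \<subseteq> A" "separated (2 * (1 / 2) ^ m) ((\<lambda>t. (t, f t)) ` T)"
      "card T = packing_number (graph_over A f) ((1 / 2) ^ m)" .
    then show ?thesis unfolding P_def by blast
  qed
  then obtain T where "\<And>m. P m (T m)" using choice[of P] by blast
  then have T: "finite (T m)" "T m \<subseteq> A" "separated (2 * (1 / 2) ^ m) ((\<lambda>t. (t, f t)) ` T m)"
      "card (T m) = packing_number (graph_over A f) ((1 / 2) ^ m)" for m
    unfolding P_def by simp_all
  have "T m \<subseteq> {0..1}" for m using T(2) A by blast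
  from AE_eventually_few_near_pairs[OF T(1) this T(3) less_imp_le[OF q(1)] q(2,3), of f]
    AE_eventually_has_modulus[OF q(1)] AE_bounded_paths
  show ?thesis
  proof eventually_elim
    case (elim \<omega>)
    from elim(1,2) show ?case
    proof eventually_elim
      case (elim m)
      let ?\<epsilon> = "(1 / 2 :: real) ^ m"
      have "1 \<le> q ^ m" using q(1) by (intro one_le_power) simp
      \<comment> \<open>The increment of \<open>f\<close> is that of the sum minus that of
        \<open>B\<close>. Each has norm at most
        \<open>q ^ m * max ?\<epsilon> (sqrt \<bar>i - j\<bar>)\<close>, whence the factor 2 in
        \<open>near_pairs\<close>.\<close>
      have "norm (f i - f j) \<le> 2 * q ^ m * max ?\<epsilon> (sqrt \<bar>i - j\<bar>)"
        if "i \<in> T m" "j \<in> T m" "norm ((B i \<omega> + f i) - (B j \<omega> + f j)) \<le> ?\<epsilon>" for i j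
      proof -
        let ?M = "max ?\<epsilon> (sqrt \<bar>i - j\<bar>)"
        have "i \<in> {0..1}" "j \<in> {0..1}" using that(1,2) T(2) A by blast+
        then have "norm (B i \<omega> - B j \<omega>) \<le> q ^ m * ?M"
          using elim(2) unfolding has_modulus_def by blast
        moreover have "1 * ?\<epsilon> \<le> q ^ m * ?M"
          using \<open>1 \<le> q ^ m\<close> by (intro mult_mono) simp_all
        moreover have "norm (f i - f j) \<le> norm ((B i \<omega> + f i) - (B j \<omega> + f j)) + norm (B i \<omega> - B j \<omega>)"
          using norm_triangle_ineq4[of "(B i \<omega> + f i) - (B j \<omega> + f j)" "B i \<omega> - B j \<omega>"] by simp
        ultimately show ?thesis using that(3) by linarith
      qed
      then show ?case
        unfolding T(4)[symmetric]
        using elim(1) \<open>1 < \<kappa>\<close> bounded_graph_sum[OF A f \<open>bounded ((\<lambda>t. B t \<omega>) ` {0..1})\<close>]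
        by (intro card_times_le_packing_number[OF _ _ T(1,2)]) simp_all
    qed
  qed
qed

text \<open>An optimal packing of the graph of \<open>B\<close> has random times. They are dominated by deterministic ones:
  the largest set of times that is separated by the graph of some function with the modulus of
  continuity of \<open>B\<close>.\<close>

lemma AE_packing_number_brownian_le:
  fixes f :: "real \<Rightarrow> real ^ 'd"
  assumes A: "A \<subseteq> {0..1}" and f: "bounded (f ` {0..1})" and "1 < \<kappa>"
  shows "AE \<omega> in M. \<forall>\<^sub>F m in sequentially. real (packing_number (graph_over A (\<lambda>t. B t \<omega>)) ((1 / 2) ^ m))
    \<le> \<kappa> ^ m * real (packing_number (graph_over A (\<lambda>t. B t \<omega> + f t)) (1 / 8 * (1 / 2) ^ m))"
proof -
  obtain q where q: "1 < q" "q \<le> 2" "q ^ CARD('d) < \<kappa>"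
    using obtain_base_below[OF \<open>1 < \<kappa>\<close>, of "CARD('d)"] by auto
  \<comment> \<open>The outcome \<omega> does not occur here, so a maximal \<open>T m\<close> and
    its witness \<open>g m\<close> can be fixed before any almost sure statement.\<close>
  define P where "P m T \<longleftrightarrow> finite T \<and> T \<subseteq> A \<and> (\<exists>g :: real \<Rightarrow> real ^ 'd. has_modulus (q ^ m) ((1 / 2) ^ m) g \<and>
      separated (2 * (1 / 2) ^ m) ((\<lambda>t. (t, g t)) ` T))" for m T
  have q_nonneg: "0 \<le> q ^ m" for m using q(1) by simp
  have "\<exists>T. P m T \<and> (\<forall>T'. P m T' \<longrightarrow> card T' \<le> card T)" for m
  proof -
    obtain b where b: "(1 + 2 * (1 + q ^ m) / (2 * (1 / 2) ^ m)) ^ DIM(real \<times> (real ^ 'd)) < real b"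
      using reals_Archimedean2 by blast
    have "card T < b" if PT: "P m T" for T
    proof -
      obtain g :: "real \<Rightarrow> real ^ 'd" where "T \<subseteq> A" and g: "has_modulus (q ^ m) ((1 / 2) ^ m) g"
          "separated (2 * (1 / 2) ^ m) ((\<lambda>t. (t, g t)) ` T)"
        using PT unfolding P_def by blast
      have "T \<subseteq> {0..1}" using \<open>T \<subseteq> A\<close> A by blast
      have "real (card T) \<le> (1 + 2 * (1 + q ^ m) / (2 * (1 / 2) ^ m)) ^ DIM(real \<times> (real ^ 'd))"
        by (rule card_separated_graph_le[OF g(1) q_nonneg _ _ \<open>T \<subseteq> {0..1}\<close> g(2)])
          (simp_all add: power_le_one)
      with b have "real (card T) < real b" by linarith
      then show ?thesis by (simp only: of_nat_less_iff)
    qed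
    moreover have "P m {}"
    proof -
      have "has_modulus (q ^ m) ((1 / 2) ^ m) (\<lambda>_. 0 :: real ^ 'd)"
        unfolding has_modulus_def using q_nonneg[of m] by (simp add: le_max_iff_disj)
      then show ?thesis unfolding P_def separated_def by auto
    qed
    ultimately show ?thesis by (intro ex_has_greatest_nat) auto
  qed
  then have "\<forall>m. \<exists>T. P m T \<and> (\<forall>T'. P m T' \<longrightarrow> card T' \<le> card T)" by blast
  from choice[OF this] obtain T where
    T: "\<And>m. P m (T m)" "\<And>m T'. P m T' \<Longrightarrow> card T' \<le> card (T m)" by blast
  have "\<forall>m. \<exists>g :: real \<Rightarrow> real ^ 'd. has_modulus (q ^ m) ((1 / 2) ^ m) g \<and>
      separated (2 * (1 / 2) ^ m) ((\<lambda>t. (t, g t)) ` T m)"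
    using T(1) unfolding P_def by simp
  from choice[OF this] obtain g :: "nat \<Rightarrow> real \<Rightarrow> real ^ 'd"
    where g: "\<And>m. has_modulus (q ^ m) ((1 / 2) ^ m) (g m)"
      "\<And>m. separated (2 * (1 / 2) ^ m) ((\<lambda>t. (t, g m t)) ` T m)"
    by blast
  have T': "finite (T m)" "T m \<subseteq> A" for m using T(1)[of m] unfolding P_def by simp_all
  have "T m \<subseteq> {0..1}" for m using T'(2) A by blast
  from AE_eventually_few_near_pairs[OF T'(1) this g(2) less_imp_le[OF q(1)] q(2,3), of f]
    AE_eventually_has_modulus[OF q(1)] AE_bounded_paths
  show ?thesis
  proof eventually_elim
    case (elim \<omega>)
    have bounded_B: "bounded (graph_over A (\<lambda>t. B t \<omega>))"
      using A elim(3) by (rule bounded_graph_over)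
    from elim(1,2) show ?case
    proof eventually_elim
      case (elim m)
      let ?\<epsilon> = "(1 / 2 :: real) ^ m"
      obtain S where S: "finite S" "S \<subseteq> A" "separated (2 * ?\<epsilon>) ((\<lambda>t. (t, B t \<omega>)) ` S)"
          "card S = packing_number (graph_over A (\<lambda>t. B t \<omega>)) ?\<epsilon>"
        using packing_number_graph_attained[OF bounded_B, of ?\<epsilon>] by auto
      \<comment> \<open>The path of \<open>B\<close> is itself a witness for \<open>S\<close>, since
        it eventually has the required modulus.\<close>
      have "P m S" unfolding P_def using S(1-3) elim(2) by blast
      then have "real (packing_number (graph_over A (\<lambda>t. B t \<omega>)) ?\<epsilon>) \<le> real (card (T m))"
        unfolding S(4)[symmetric] by (intro of_nat_mono T(2))
      also have "\<dots> \<le> \<kappa> ^ m * real (packing_number (graph_over A (\<lambda>t. B t \<omega> + f t)) (1 / 8 * ?\<epsilon>))"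
      proof (rule card_times_le_packing_number[OF _ _ T' _ elim(1)])
        show "bounded (graph_over A (\<lambda>t. B t \<omega> + f t))"
          by (rule bounded_graph_sum[OF A f \<open>bounded ((\<lambda>t. B t \<omega>) ` {0..1})\<close>])
        fix i j assume "i \<in> T m" "j \<in> T m"
        then have "i \<in> {0..1}" "j \<in> {0..1}" using T'(2) A by blast+
        then have "norm (g m i - g m j) \<le> q ^ m * max ?\<epsilon> (sqrt \<bar>i - j\<bar>)"
          using g(1)[of m] unfolding has_modulus_def by blast
        also have "\<dots> \<le> 2 * q ^ m * max ?\<epsilon> (sqrt \<bar>i - j\<bar>)"
          using q_nonneg[of m] by (intro mult_right_mono) (simp_all add: le_max_iff_disj)
        finally show "norm (g m i - g m j) \<le> 2 * q ^ m * max ?\<epsilon> (sqrt \<bar>i - j\<bar>)" .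
      qed (use \<open>1 < \<kappa>\<close> in simp_all)
      finally show ?case .
    qed
  qed
qed

end

theorem theorem1p7:
  fixes M :: "'w measure"
    and B :: "real \<Rightarrow> 'w \<Rightarrow> real ^ 'd"
    and f :: "real \<Rightarrow> real ^ 'd"
    and A :: "real set"
  assumes "standard_brownian_motion M B"
    and "cadlag_on 0 1 f"
    and "A \<subseteq> {0..1}" and "A \<noteq> {}"
  shows "AE \<omega> in M.
      upper_minkowski_dim (graph_over A (\<lambda>t. B t \<omega> + f t))
        \<ge> max (upper_minkowski_dim (graph_over A (\<lambda>t. B t \<omega>)))
              (upper_minkowski_dim (graph_over A f)) \<and>
      lower_minkowski_dim (graph_over A (\<lambda>t. B t \<omega> + f t))
        \<ge> max (lower_minkowski_dim (graph_over A (\<lambda>t. B t \<omega>)))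
              (lower_minkowski_dim (graph_over A f))"
proof -
  interpret standard_brownian_motion M B by fact
  have f: "bounded (f ` {0..1})" using assms(2) by (rule cadlag_on_bounded) simp
  \<comment> \<open>The exceptional null set depends on the factor; a sequence decreasing to 1 keeps
    their union null, and \<open>dominated\<close> recovers every factor above 1.\<close>
  define \<kappa> where "\<kappa> k = 1 + 1 / real (Suc k)" for k
  have \<kappa>: "1 < \<kappa> k" for k unfolding \<kappa>_def by simp
  have dominated: "\<forall>\<^sub>F m in sequentially. p m \<le> x ^ m * real (r m)"
    if "\<forall>k. \<forall>\<^sub>F m in sequentially. p m \<le> \<kappa> k ^ m * real (r m)" "1 < x" for p r x
  proof -
    obtain k where "1 / real (Suc k) < x - 1"
      using reals_Archimedean[of "x - 1"] \<open>1 < x\<close> by (auto simp: inverse_eq_divide)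
    then have "\<kappa> k \<le> x" unfolding \<kappa>_def by simp
    from that(1) have "\<forall>\<^sub>F m in sequentially. p m \<le> \<kappa> k ^ m * real (r m)" by blast
    then show ?thesis
    proof eventually_elim
      case (elim m)
      have "\<kappa> k ^ m * real (r m) \<le> x ^ m * real (r m)"
        using \<open>\<kappa> k \<le> x\<close> \<kappa>[of k] by (intro mult_right_mono power_mono) simp_all
      with elim show ?case by (rule order_trans)
    qed
  qed
  let ?X = "\<lambda>\<omega>. graph_over A (\<lambda>t. B t \<omega> + f t)"
  have "AE \<omega> in M. \<forall>k. \<forall>\<^sub>F m in sequentially. real (packing_number (graph_over A f) ((1 / 2) ^ m))
      \<le> \<kappa> k ^ m * real (packing_number (?X \<omega>) (1 / 8 * (1 / 2) ^ m))"
    unfolding AE_all_countable by (intro allI AE_packing_number_drift_le assms(3) f \<kappa>)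
  moreover have "AE \<omega> in M. \<forall>k. \<forall>\<^sub>F m in sequentially.
      real (packing_number (graph_over A (\<lambda>t. B t \<omega>)) ((1 / 2) ^ m))
      \<le> \<kappa> k ^ m * real (packing_number (?X \<omega>) (1 / 8 * (1 / 2) ^ m))"
    unfolding AE_all_countable by (intro allI AE_packing_number_brownian_le assms(3) f \<kappa>)
  ultimately show ?thesis using AE_bounded_paths
  proof eventually_elim
    case (elim \<omega>)
    have ne: "graph_over A h \<noteq> {}" for h :: "real \<Rightarrow> real ^ 'd"
      unfolding graph_over_eq_image using assms(4) by simp
    note X = bounded_graph_sum[OF assms(3) f elim(3)]
    note Gf = bounded_graph_over[OF assms(3) f]
    note GB = bounded_graph_over[OF assms(3) elim(3)]
    show ?case
      using minkowski_dim_le[OF Gf ne X ne _ dominated[OF elim(1)]]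
        minkowski_dim_le[OF GB ne X ne _ dominated[OF elim(2)]] by simp
  qed
qed

end
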